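(* If $\Sigma^{2n-1}$ is a compact CMC real hypersurface in $\mathbb{C}H^n$ with sectional curvature $K\geq -1$, then there exists a point $p\in\Sigma^{2n-1}$ such that, at $p$, $$|A|>C(n,|H|)=\frac{\sqrt{(8n+17)(2n-1)^2|H|^2+32(n^2-1)}-3(2n-1)|H|}{4(n+1)}.$$
   Context: $\mathbb{C}H^n$ is the complex hyperbolic space of complex dimension $n$ with constant holomorphic sectional curvature $-4$. A real hypersurface is a submanifold of real codimension one; $A$ is its shape operator with respect to a unit normal vector field, $|A|$ its norm ($|A|^2$ is the sum of squares of the principal curvatures), and $H=\frac{1}{2n-1}\operatorname{trace}\sigma$ its mean curvature vector field, where $\sigma$ is the second fundamental form. CMC means $|H|$ is constant. *)

theory Defs
  imports "HOL-Analysis.Analysis"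
begin

section \<open>Smooth maps and smooth manifolds\<close>

text \<open>The set \<open>U\<close> is meant to be an open subset of a Euclidean space.\<close>

primrec Ck_on :: "nat \<Rightarrow> 'e::euclidean_space set \<Rightarrow> ('e \<Rightarrow> 'f::euclidean_space) \<Rightarrow> bool" where
  "Ck_on 0 U f \<longleftrightarrow> continuous_on U f"
| "Ck_on (Suc k) U f \<longleftrightarrow> (\<forall>x\<in>U. f differentiable (at x)) \<and>
     (\<forall>v. Ck_on k U (\<lambda>x. frechet_derivative f (at x) v))"

definition smooth_on :: "'e::euclidean_space set \<Rightarrow> ('e \<Rightarrow> 'f::euclidean_space) \<Rightarrow> bool" where
  "smooth_on U f \<longleftrightarrow> (\<forall>k. Ck_on k U f)"

text \<open>A chart is given by its inverse, a parametrization \<open>\<phi>\<close> of an open subset of the space by an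
  open set \<open>V\<close> of \<open>\<real>\<^sup>m\<close>; values of \<open>\<phi>\<close> outside \<open>V\<close> are irrelevant.\<close>

type_synonym ('m, 'a) param = "(real ^ 'm) set \<times> (real ^ 'm \<Rightarrow> 'a)"

definition smooth_atlas :: "'a topology \<Rightarrow> ('m::finite, 'a) param set \<Rightarrow> bool" where
  "smooth_atlas M \<A> \<longleftrightarrow>
     (\<forall>(V, \<phi>)\<in>\<A>. open V \<and> openin M (\<phi> ` V) \<and>
        homeomorphic_map (top_of_set V) (subtopology M (\<phi> ` V)) \<phi>) \<and>
     (\<Union>(V, \<phi>)\<in>\<A>. \<phi> ` V) = topspace M \<and>
     (\<forall>(V, \<phi>)\<in>\<A>. \<forall>(W, \<psi>)\<in>\<A>. smooth_on (V \<inter> \<phi> -` (\<psi> ` W)) (inv_into W \<psi> \<circ> \<phi>))"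

definition smooth_manifold :: "'a topology \<Rightarrow> ('m::finite, 'a) param set \<Rightarrow> bool" where
  "smooth_manifold M \<A> \<longleftrightarrow> Hausdorff_space M \<and> second_countable M \<and> smooth_atlas M \<A>"


section \<open>Riemannian geometry on open sets of Euclidean spaces\<close>

text \<open>A metric \<open>g\<close> assigns to a point \<open>p\<close> the inner product \<open>g p\<close> on tangent vectors, the tangent
  spaces being identified with the ambient vector space.\<close>

type_synonym 'e metric = "'e \<Rightarrow> 'e \<Rightarrow> 'e \<Rightarrow> real"

definition metric_norm :: "'e::euclidean_space metric \<Rightarrow> 'e \<Rightarrow> 'e \<Rightarrow> real" where
  "metric_norm g p v = sqrt (g p v v)"

text \<open>Koszul's formula for constant vector fields: \<open>christoffel g p u v\<close> is the Levi-Civita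
  derivative at \<open>p\<close> of the constant field \<open>v\<close> in direction \<open>u\<close>.\<close>

definition christoffel :: "'e::euclidean_space metric \<Rightarrow> 'e \<Rightarrow> 'e \<Rightarrow> 'e \<Rightarrow> 'e" where
  "christoffel g p u v = (THE c. \<forall>w. 2 * g p c w =
       frechet_derivative (\<lambda>q. g q v w) (at p) u
     + frechet_derivative (\<lambda>q. g q u w) (at p) v
     - frechet_derivative (\<lambda>q. g q u v) (at p) w)"

text \<open>Levi-Civita derivative at \<open>s\<close>, in direction \<open>v\<close>, of a vector field \<open>W\<close> along a map \<open>x\<close>.\<close>

definition cov_along ::
  "'e::euclidean_space metric \<Rightarrow> ('d::euclidean_space \<Rightarrow> 'e) \<Rightarrow> 'd \<Rightarrow> ('d \<Rightarrow> 'e) \<Rightarrow> 'd \<Rightarrow> 'e" where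
  "cov_along g x v W s =
     frechet_derivative W (at s) v
     + christoffel g (x s) (frechet_derivative x (at s) v) (W s)"

text \<open>\<open>R(u,v)w = \<nabla>\<^sub>u \<nabla>\<^sub>v w - \<nabla>\<^sub>v \<nabla>\<^sub>u w\<close>, with \<open>u\<close>, \<open>v\<close>, \<open>w\<close> extended to constant fields,
  so that the bracket term vanishes.\<close>

definition curvature :: "'e::euclidean_space metric \<Rightarrow> 'e \<Rightarrow> 'e \<Rightarrow> 'e \<Rightarrow> 'e \<Rightarrow> 'e" where
  "curvature g p u v w =
     cov_along g (\<lambda>q. q) u (cov_along g (\<lambda>q. q) v (\<lambda>_. w)) p
     - cov_along g (\<lambda>q. q) v (cov_along g (\<lambda>q. q) u (\<lambda>_. w)) p"

definition sectional_curvature :: "'e::euclidean_space metric \<Rightarrow> 'e \<Rightarrow> 'e \<Rightarrow> 'e \<Rightarrow> real" where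
  "sectional_curvature g p u v =
     g p (curvature g p u v v) u / (g p u u * g p v v - (g p u v)\<^sup>2)"


section \<open>Submanifold geometry in a parametrization\<close>

text \<open>In this section \<open>x\<close> is an immersion of an open set of \<open>\<real>\<^sup>m\<close> into an open set
  with metric \<open>g\<close>, and \<open>s\<close> is a point of its domain; tangent vectors of the submanifold are
  represented by their coordinates in \<open>\<real>\<^sup>m\<close>.\<close>

definition induced_metric ::
  "'e::euclidean_space metric \<Rightarrow> ('d::euclidean_space \<Rightarrow> 'e) \<Rightarrow> 'd metric" where
  "induced_metric g x s v w =
     g (x s) (frechet_derivative x (at s) v) (frechet_derivative x (at s) w)"

definition normal_vector ::
  "'e::euclidean_space metric \<Rightarrow> ('d::euclidean_space \<Rightarrow> 'e) \<Rightarrow> 'd \<Rightarrow> 'e \<Rightarrow> bool" where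
  "normal_vector g x s \<nu> \<longleftrightarrow> (\<forall>v. g (x s) \<nu> (frechet_derivative x (at s) v) = 0)"

definition unit_normal ::
  "'e::euclidean_space metric \<Rightarrow> ('d::euclidean_space \<Rightarrow> 'e) \<Rightarrow> 'd \<Rightarrow> 'e \<Rightarrow> bool" where
  "unit_normal g x s \<nu> \<longleftrightarrow> normal_vector g x s \<nu> \<and> metric_norm g (x s) \<nu> = 1"

definition normal_part ::
  "'e::euclidean_space metric \<Rightarrow> ('d::euclidean_space \<Rightarrow> 'e) \<Rightarrow> 'd \<Rightarrow> 'e \<Rightarrow> 'e" where
  "normal_part g x s z =
     (THE \<nu>. normal_vector g x s \<nu> \<and> z - \<nu> \<in> range (frechet_derivative x (at s)))"

text \<open>\<open>\<sigma>(v,w)\<close> is the normal part of the ambient derivative of \<open>w\<close> in direction \<open>v\<close>, where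
  \<open>w\<close> is extended to the tangent field with constant coordinates.\<close>

definition second_fundamental_form ::
  "'e::euclidean_space metric \<Rightarrow> ('d::euclidean_space \<Rightarrow> 'e) \<Rightarrow> 'd \<Rightarrow> 'd \<Rightarrow> 'd \<Rightarrow> 'e" where
  "second_fundamental_form g x s v w =
     normal_part g x s (cov_along g x v (\<lambda>r. frechet_derivative x (at r) w) s)"

definition gram :: "'e::euclidean_space metric \<Rightarrow> (real ^ 'm \<Rightarrow> 'e) \<Rightarrow> real ^ 'm \<Rightarrow> real ^ 'm ^ 'm" where
  "gram g x s = (\<chi> i j. induced_metric g x s (axis i 1) (axis j 1))"

text \<open>\<open>H = m\<^sup>-\<^sup>1 g\<^sup>i\<^sup>j \<sigma>\<^sub>i\<^sub>j\<close>, where \<open>m\<close> is the dimension of the submanifold.\<close>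

definition mean_curvature_vector ::
  "'e::euclidean_space metric \<Rightarrow> (real ^ 'm \<Rightarrow> 'e) \<Rightarrow> real ^ 'm \<Rightarrow> 'e" where
  "mean_curvature_vector g x s =
     (1 / real CARD('m)) *\<^sub>R (\<Sum>i\<in>UNIV. \<Sum>j\<in>UNIV.
        (matrix_inv (gram g x s) $ i $ j) *\<^sub>R
          second_fundamental_form g x s (axis i 1) (axis j 1))"

text \<open>The shape operator \<open>A\<close> of the normal vector \<open>\<nu>\<close>: \<open>\<langle>A v, w\<rangle> = \<langle>\<sigma>(v,w), \<nu>\<rangle>\<close>.\<close>

definition shape_operator ::
  "'e::euclidean_space metric \<Rightarrow> ('d::euclidean_space \<Rightarrow> 'e) \<Rightarrow> 'd \<Rightarrow> 'e \<Rightarrow> 'd \<Rightarrow> 'd" where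
  "shape_operator g x s \<nu> v =
     (THE a. \<forall>w. induced_metric g x s a w = g (x s) (second_fundamental_form g x s v w) \<nu>)"

definition principal_curvatures ::
  "'e::euclidean_space metric \<Rightarrow> ('d::euclidean_space \<Rightarrow> 'e) \<Rightarrow> 'd \<Rightarrow> 'e \<Rightarrow> real set" where
  "principal_curvatures g x s \<nu> = {c. \<exists>v. v \<noteq> 0 \<and> shape_operator g x s \<nu> v = c *\<^sub>R v}"

text \<open>\<open>|A|\<^sup>2\<close> is the sum of the squares of the principal curvatures, each repeated according
  to the dimension of its eigenspace.\<close>

definition shape_norm ::
  "'e::euclidean_space metric \<Rightarrow> ('d::euclidean_space \<Rightarrow> 'e) \<Rightarrow> 'd \<Rightarrow> 'e \<Rightarrow> real" where
  "shape_norm g x s \<nu> = sqrt (\<Sum>c\<in>principal_curvatures g x s \<nu>.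
     real (dim {v. shape_operator g x s \<nu> v = c *\<^sub>R v}) * c\<^sup>2)"


section \<open>Complex hyperbolic space and its real hypersurfaces\<close>

definition hermitian :: "complex ^ 'n \<Rightarrow> complex ^ 'n \<Rightarrow> complex" where
  "hermitian u v = (\<Sum>i\<in>UNIV. u $ i * cnj (v $ i))"

text \<open>The ball model of \<open>\<complex>H\<^sup>n\<close>: the open unit ball of \<open>\<complex>\<^sup>n\<close> with the Bergman metric, scaled so
  that its Hermitian matrix is the complex Hessian of \<open>- log (1 - |z|\<^sup>2)\<close>. This scaling gives
  holomorphic sectional curvature \<open>-4\<close>: on a complex line through \<open>0\<close>, which is totally geodesic,
  the metric is \<open>|dz|\<^sup>2 / (1 - |z|\<^sup>2)\<^sup>2\<close>.\<close>

definition CH_ball :: "(complex ^ 'n) set" where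
  "CH_ball = ball 0 1"

definition CH_metric :: "(complex ^ 'n) metric" where
  "CH_metric z u v =
     Re ((1 - (norm z)\<^sup>2) * hermitian u v + hermitian u z * hermitian z v) / (1 - (norm z)\<^sup>2)\<^sup>2"

text \<open>An immersed real hypersurface: a smooth manifold \<open>M\<close> of dimension \<open>2n - 1\<close>, with atlas \<open>\<A>\<close>,
  together with a smooth immersion \<open>f\<close> into the ball.\<close>

definition real_hypersurface ::
  "'a topology \<Rightarrow> ('m::finite, 'a) param set \<Rightarrow> ('a \<Rightarrow> complex ^ 'n::finite) \<Rightarrow> bool" where
  "real_hypersurface M \<A> f \<longleftrightarrow>
     CARD('m) = 2 * CARD('n) - 1 \<and> smooth_manifold M \<A> \<and> f ` topspace M \<subseteq> CH_ball \<and>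
     (\<forall>(V, \<phi>)\<in>\<A>. smooth_on V (f \<circ> \<phi>) \<and>
        (\<forall>s\<in>V. inj (frechet_derivative (f \<circ> \<phi>) (at s))))"

text \<open>The curvature quantities do not depend on the chart used to compute them, so conditions
  on them are imposed in all charts of the atlas.\<close>

definition constant_mean_curvature ::
  "('m::finite, 'a) param set \<Rightarrow> ('a \<Rightarrow> complex ^ 'n::finite) \<Rightarrow> real \<Rightarrow> bool" where
  "constant_mean_curvature \<A> f h \<longleftrightarrow>
     (\<forall>(V, \<phi>)\<in>\<A>. \<forall>s\<in>V.
        metric_norm CH_metric (f (\<phi> s)) (mean_curvature_vector CH_metric (f \<circ> \<phi>) s) = h)"

definition sectional_curvature_ge ::
  "('m::finite, 'a) param set \<Rightarrow> ('a \<Rightarrow> complex ^ 'n::finite) \<Rightarrow> real \<Rightarrow> bool" where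
  "sectional_curvature_ge \<A> f k \<longleftrightarrow>
     (\<forall>(V, \<phi>)\<in>\<A>. \<forall>s\<in>V. \<forall>v w. v \<noteq> w \<and> independent {v, w} \<longrightarrow>
        sectional_curvature (induced_metric CH_metric (f \<circ> \<phi>)) s v w \<ge> k)"

definition C_bound :: "nat \<Rightarrow> real \<Rightarrow> real" where
  "C_bound n h =
     (sqrt ((8 * real n + 17) * (2 * real n - 1)\<^sup>2 * h\<^sup>2 + 32 * ((real n)\<^sup>2 - 1))
        - 3 * (2 * real n - 1) * h) / (4 * (real n + 1))"

end

theory Submission
  imports Defs
begin

text \<open>At a point of the hypersurface at maximal distance from the origin of the ball, the
  hypersurface touches from inside a geodesic sphere centred at the origin, whose principal
  curvatures are at least 1. Hence, for one of the two unit normals, all principal curvatures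
  there are at least 1. With \<open>m = 2n - 1\<close> and \<open>t = m |H| = trace A\<close> this gives \<open>t \<ge> m\<close>,
  and Cauchy--Schwarz gives \<open>m |A|\<^sup>2 \<ge> t\<^sup>2\<close>. Clearing the root, \<open>|A| > C(n,|H|)\<close> amounts to
  \<open>2(n + 1)|A|\<^sup>2 + 3|A|t > t\<^sup>2 + 4(n - 1)\<close>, which holds since
  \<open>2(n + 1)|A|\<^sup>2 = m|A|\<^sup>2 + 3|A|\<^sup>2 \<ge> t\<^sup>2 + 3m\<close>.\<close>

section \<open>Simultaneous diagonalization of symmetric bilinear forms\<close>

text \<open>The metric varies from point to point and is not the inner product of the type class, so
  the linear algebra is done for a pair of forms: a positive definite \<open>B\<close> and a
  symmetric \<open>S\<close>. The obstacle is that \<open>shape_norm\<close> is defined through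
  eigenspaces and the mean curvature through an inverse Gram matrix in coordinates. A basis that is
  \<open>B\<close>-orthonormal and \<open>S\<close>-diagonal turns both into sums over the same
  numbers \<open>S e e\<close>. The contact with a geodesic sphere is never formalized. It is
  replaced by the second derivative test for |x|^2: at the maximum the position vector is normal,
  and the sign of the second derivative bounds the second fundamental form. The radius r of the
  sphere satisfies |z| = tanh r, and the test yields the bound 1/|z| = coth r, the smaller principal
  curvature of the sphere. The conclusion concerns both unit normals, so the estimates are arranged
  to involve only the absolute value of the trace. Strictness comes from 3m = 6n - 3 > 4(n -
  1).\<close>

definition pos_def_form :: "('a::euclidean_space \<Rightarrow> 'a \<Rightarrow> real) \<Rightarrow> bool" where
  "pos_def_form B \<longleftrightarrow> bilinear B \<and> (\<forall>u v. B u v = B v u) \<and> (\<forall>u. u \<noteq> 0 \<longrightarrow> 0 < B u u)"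

lemma pos_def_formD:
  assumes "pos_def_form B"
  shows "bilinear B" "B u v = B v u" "u \<noteq> 0 \<Longrightarrow> 0 < B u u" "B u u = 0 \<longleftrightarrow> u = 0"
proof -
  show b: "bilinear B" and "B u v = B v u" and p: "u \<noteq> 0 \<Longrightarrow> 0 < B u u"
    using assms unfolding pos_def_form_def by blast+
  show "B u u = 0 \<longleftrightarrow> u = 0"
    using p bilinear_lzero[OF b] by (cases "u = 0"; simp; fastforce)
qed

lemma pos_def_form_eqI:
  assumes "pos_def_form B" "\<And>w. B u w = B v w"
  shows "u = v"
proof -
  have "B (u - v) (u - v) = 0"
    using bilinear_lsub[OF pos_def_formD(1)[OF assms(1)]] assms(2) by simp
  then show ?thesis using pos_def_formD(4)[OF assms(1)] by simp
qed

text \<open>Riesz representation: sending \<open>c\<close> to the values of \<open>B c\<close> on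
  the standard basis is linear and injective, hence surjective. It supplies the existence half of
  the \<open>THE\<close> in \<open>shape_operator\<close>.\<close>

lemma pos_def_form_represents:
  fixes B :: "'a::euclidean_space \<Rightarrow> 'a \<Rightarrow> real"
  assumes B: "pos_def_form B" and L: "linear L"
  obtains c where "\<And>w. B c w = L w"
proof -
  have b: "bilinear B" using B by (rule pos_def_formD)
  define T where "T c = (\<Sum>i\<in>Basis. B c i *\<^sub>R i)" for c
  have Ti: "T c \<bullet> i = B c i" if "i \<in> Basis" for c i
    using that by (simp add: T_def)
  have linB: "linear (B c)" for c using b by (simp add: bilinear_def)
  have lin: "linear T"
    by (rule linearI)
      (simp_all add: T_def bilinear_ladd[OF b] bilinear_lmul[OF b] scaleR_left_distrib sum.distrib
        scaleR_sum_right)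
  have "inj T"
  proof (rule injI)
    fix u v assume "T u = T v"
    then have "B u i = B v i" if "i \<in> Basis" for i using that Ti by metis
    then have "B u = B v" using linear_eq_stdbasis[OF linB linB] by blast
    then show "u = v" using pos_def_form_eqI[OF B] by metis
  qed
  then obtain c where c: "T c = (\<Sum>i\<in>Basis. L i *\<^sub>R i)"
    using linear_injective_imp_surjective[OF lin] by (metis surjD)
  have "B c i = L i" if "i \<in> Basis" for i
    using that Ti[OF that, of c] by (simp add: c)
  then have "B c = L" using linear_eq_stdbasis[OF linB L] by blast
  then show thesis using that by metis
qed

definition orthonormal_wrt :: "('a::real_vector \<Rightarrow> 'a \<Rightarrow> real) \<Rightarrow> 'a set \<Rightarrow> bool" where
  "orthonormal_wrt B E \<longleftrightarrow> (\<forall>e\<in>E. \<forall>e'\<in>E. B e e' = (if e = e' then 1 else 0))"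

lemma orthonormal_wrt_sum:
  assumes b: "bilinear B" and E: "orthonormal_wrt B E" "finite E" and "F \<subseteq> E" "e \<in> E"
  shows "B (\<Sum>e\<in>F. a e *\<^sub>R e) e = (if e \<in> F then a e else 0)"
proof -
  have lin: "linear (\<lambda>u. B u e)" using b by (simp add: bilinear_def)
  have fin: "finite F" using assms finite_subset by blast
  have "B (\<Sum>e\<in>F. a e *\<^sub>R e) e = (\<Sum>e'\<in>F. a e' * B e' e)"
    by (simp add: linear_sum[OF lin] linear_cmul[OF lin])
  also have "\<dots> = (\<Sum>e'\<in>F. if e' = e then a e' else 0)"
    using E(1) assms(4,5) by (intro sum.cong) (auto simp: orthonormal_wrt_def subset_iff)
  also have "\<dots> = (if e \<in> F then a e else 0)" using fin by simp
  finally show ?thesis .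
qed

lemma orthonormal_wrt_independent:
  assumes b: "bilinear B" and E: "orthonormal_wrt B E" "finite E"
  shows "independent E"
proof (rule independent_if_scalars_zero[OF E(2)])
  fix a e assume "(\<Sum>x\<in>E. a x *\<^sub>R x) = 0" "e \<in> E"
  then show "a e = 0"
    using orthonormal_wrt_sum[OF b E subset_refl \<open>e \<in> E\<close>, of a] by (simp add: bilinear_lzero[OF b])
qed

text \<open>Along the line \<open>t *\<^sub>R e + w\<close> the form is affine in \<open>t\<close>
  with slope \<open>2 * Q e w\<close>, so a nonzero slope would make it negative somewhere. This
  yields the eigenvector equation below without differentiating a Rayleigh quotient.\<close>

lemma nonneg_form_radical:
  fixes Q :: "'a::real_vector \<Rightarrow> 'a \<Rightarrow> real"
  assumes b: "bilinear Q" and sym: "\<And>u v. Q u v = Q v u"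
    and W: "subspace W" "\<And>w. w \<in> W \<Longrightarrow> 0 \<le> Q w w"
    and e: "e \<in> W" "Q e e = 0" and w: "w \<in> W"
  shows "Q e w = 0"
proof (rule ccontr)
  assume ne: "Q e w \<noteq> 0"
  \<comment> \<open>Chosen so that the form takes the value -1 on the line.\<close>
  define t where "t = - (1 + Q w w) / (2 * Q e w)"
  have "t *\<^sub>R e + w \<in> W" using W(1) e w by (simp add: subspace_add subspace_scale)
  then have "0 \<le> Q (t *\<^sub>R e + w) (t *\<^sub>R e + w)" by (rule W(2))
  also have "\<dots> = 2 * t * Q e w + Q w w"
    using e sym[of w e]
    by (simp add: bilinear_ladd[OF b] bilinear_radd[OF b] bilinear_lmul[OF b] bilinear_rmul[OF b])
  also have "\<dots> = - 1" using ne by (simp add: t_def field_simps)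
  finally show False by simp
qed

text \<open>Spectral theorem for \<open>S\<close> relative to \<open>B\<close>, by splitting off a
  maximizer of the Rayleigh quotient. It is stated for a subspace so that the induction can pass to
  a \<open>B\<close>-orthogonal complement.\<close>

lemma simultaneous_diagonalization:
  fixes B S :: "'a::euclidean_space \<Rightarrow> 'a \<Rightarrow> real"
  assumes B: "pos_def_form B" and S: "bilinear S" "\<And>u v. S u v = S v u"
    and "subspace W"
  shows "\<exists>E\<subseteq>W. finite E \<and> card E = dim W \<and> orthonormal_wrt B E \<and>
    (\<forall>e\<in>E. \<forall>e'\<in>E. e \<noteq> e' \<longrightarrow> S e e' = 0) \<and> (\<forall>w\<in>W. w = (\<Sum>e\<in>E. B w e *\<^sub>R e))"
  using assms(4)
proof (induction "dim W" arbitrary: W)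
  case 0
  then have "W = {0}" using subspace_0 by (auto simp: dim_eq_0)
  then show ?case by (intro exI[of _ "{}"]) (auto simp: orthonormal_wrt_def)
next
  case (Suc d)
  note b = pos_def_formD(1)[OF B] and W = \<open>subspace W\<close>
  have bS: "bounded_bilinear S" and bB: "bounded_bilinear B"
    using S b by (simp_all add: bilinear_conv_bounded_bilinear)
  \<comment> \<open>The Euclidean unit sphere is used for compactness. The quotient is homogeneous
    of degree 0, so its maximum there is the maximum over all nonzero vectors of
    \<open>W\<close>.\<close>
  let ?K = "sphere 0 1 \<inter> W"
  have "compact ?K" using closed_subspace[OF W] by (simp add: compact_Int_closed)
  moreover have "?K \<noteq> {}"
  proof -
    obtain w where "w \<in> W" "w \<noteq> 0"
      using Suc(2) by (metis dim_eq_0 Zero_not_Suc singletonI subsetI)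
    then have "(1 / norm w) *\<^sub>R w \<in> ?K" using W by (simp add: subspace_scale)
    then show ?thesis by blast
  qed
  moreover have "continuous_on ?K (\<lambda>w. S w w / B w w)"
  proof (rule continuous_on_divide)
    show "continuous_on ?K (\<lambda>w. S w w)" "continuous_on ?K (\<lambda>w. B w w)"
      by (rule bounded_bilinear.continuous_on[OF bS continuous_on_id continuous_on_id]
          bounded_bilinear.continuous_on[OF bB continuous_on_id continuous_on_id])+
    show "\<forall>w\<in>?K. B w w \<noteq> 0"
    proof
      fix w assume "w \<in> ?K"
      then have "w \<noteq> 0" by auto
      then show "B w w \<noteq> 0" by (simp add: pos_def_formD(4)[OF B])
    qed
  qed
  ultimately obtain u where u: "u \<in> ?K" "\<And>w. w \<in> ?K \<Longrightarrow> S w w / B w w \<le> S u u / B u u"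
    using continuous_attains_sup[of ?K "\<lambda>w. S w w / B w w"] by metis
  define l where "l = S u u / B u u"
  \<comment> \<open>Maximality of \<open>l\<close> makes \<open>Q\<close> nonnegative on
    \<open>W\<close>, and \<open>Q u u = 0\<close>. Hence \<open>u\<close> lies in the radical,
    which says that \<open>S u w = l * B u w\<close> on \<open>W\<close>.\<close>
  define Q where "Q v w = l * B v w - S v w" for v w
  have u0: "u \<noteq> 0" "u \<in> W" using u by auto
  have Bu: "0 < B u u" using pos_def_formD(3)[OF B u0(1)] .
  have bQ: "bilinear Q"
    unfolding bilinear_def
    by (intro conjI allI linearI)
      (simp_all add: Q_def bilinear_ladd[OF b] bilinear_radd[OF b] bilinear_lmul[OF b]
        bilinear_rmul[OF b] bilinear_ladd[OF S(1)] bilinear_radd[OF S(1)] bilinear_lmul[OF S(1)]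
        bilinear_rmul[OF S(1)] algebra_simps)
  have Qpos: "0 \<le> Q w w" if w: "w \<in> W" for w
  proof (cases "w = 0")
    case True then show ?thesis by (simp add: bilinear_lzero[OF bQ])
  next
    case False
    define w' where "w' = (1 / norm w) *\<^sub>R w"
    have "w' \<in> ?K" using False W w by (simp add: w'_def subspace_scale)
    then have "S w' w' / B w' w' \<le> l" using u(2) by (simp add: l_def)
    moreover have "S w' w' / B w' w' = S w w / B w w"
      using False by (simp add: w'_def bilinear_lmul[OF b] bilinear_rmul[OF b]
          bilinear_lmul[OF S(1)] bilinear_rmul[OF S(1)])
    ultimately have "S w w / B w w \<le> l" by simp
    then show ?thesis using pos_def_formD(3)[OF B False] by (simp add: Q_def field_simps)
  qed
  have Qu: "Q u w = 0" if "w \<in> W" for w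
  proof (rule nonneg_form_radical[OF bQ _ W Qpos u0(2) _ that])
    show "Q v w = Q w v" for v w using pos_def_formD(2)[OF B] S(2) by (simp add: Q_def)
    show "Q u u = 0" using Bu by (simp add: Q_def l_def)
  qed
  define e where "e = (1 / sqrt (B u u)) *\<^sub>R u"
  have e: "e \<in> W" "B e e = 1"
    using u0 W Bu by (simp_all add: e_def subspace_scale bilinear_lmul[OF b] bilinear_rmul[OF b])
  have Se: "S e w = l * B e w" if "w \<in> W" for w
    using Qu[OF that] by (simp add: e_def Q_def bilinear_lmul[OF b] bilinear_lmul[OF S(1)])
  \<comment> \<open>By \<open>Se\<close>, being \<open>B\<close>-orthogonal to \<open>e\<close>
    within \<open>W\<close> implies being \<open>S\<close>-orthogonal to it, so a diagonal basis of
    \<open>W'\<close> stays diagonal after adding \<open>e\<close>.\<close>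
  define W' where "W' = {w \<in> W. B e w = 0}"
  have sub: "subspace W'"
    using W unfolding W'_def subspace_def
    by (auto simp: bilinear_rzero[OF b] bilinear_radd[OF b] bilinear_rmul[OF b])
  have proj: "w - B e w *\<^sub>R e \<in> W'" if "w \<in> W" for w
    using that e W by (simp add: W'_def subspace_diff subspace_scale bilinear_rsub[OF b] bilinear_rmul[OF b])
  have "e \<notin> span W'" using e sub by (simp add: span_eq_iff[THEN iffD2] W'_def)
  moreover have "span (insert e W') = W"
  proof
    show "span (insert e W') \<subseteq> W" using e W by (intro span_minimal) (auto simp: W'_def)
    show "W \<subseteq> span (insert e W')"
    proof
      fix w assume "w \<in> W"
      then have "w - B e w *\<^sub>R e \<in> span W'" by (intro span_base proj)
      then show "w \<in> span (insert e W')" unfolding span_breakdown_eq by (rule exI)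
    qed
  qed
  ultimately have "dim W = Suc (dim W')" by (metis dim_insert dim_span Suc_eq_plus1)
  then have "d = dim W'" using Suc(2) by simp
  from Suc(1)[OF this sub] obtain E where E: "E \<subseteq> W'" "finite E" "card E = dim W'"
    "orthonormal_wrt B E" "\<And>e e'. \<lbrakk>e \<in> E; e' \<in> E; e \<noteq> e'\<rbrakk> \<Longrightarrow> S e e' = 0"
    "\<And>w. w \<in> W' \<Longrightarrow> w = (\<Sum>e\<in>E. B w e *\<^sub>R e)" by blast
  have eE: "B e e' = 0" "B e' e = 0" "S e e' = 0" "S e' e = 0" if "e' \<in> E" for e'
    using that E(1) Se[of e'] S(2)[of e' e] pos_def_formD(2)[OF B, of e' e] by (auto simp: W'_def)
  have "e \<notin> E" using eE(1) e(2) by force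
  show ?case
  proof (intro exI[of _ "insert e E"] conjI ballI impI)
    show "insert e E \<subseteq> W" using E(1) e by (auto simp: W'_def)
    show "finite (insert e E)" using E by simp
    show "card (insert e E) = dim W" using E \<open>e \<notin> E\<close> \<open>dim W = Suc (dim W')\<close> by simp
    show "orthonormal_wrt B (insert e E)"
      using E(4) e eE \<open>e \<notin> E\<close> by (auto simp: orthonormal_wrt_def)
    show "S v w = 0" if "v \<in> insert e E" "w \<in> insert e E" "v \<noteq> w" for v w
      using that eE E(5) by auto
    fix w assume w: "w \<in> W"
    have "w - B e w *\<^sub>R e = (\<Sum>e'\<in>E. B (w - B e w *\<^sub>R e) e' *\<^sub>R e')"
      by (rule E(6)[OF proj[OF w]])
    also have "\<dots> = (\<Sum>e'\<in>E. B w e' *\<^sub>R e')"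
      by (intro sum.cong) (simp_all add: bilinear_lsub[OF b] bilinear_lmul[OF b] eE)
    finally show "w = (\<Sum>e\<in>insert e E. B w e *\<^sub>R e)"
      using E(2) \<open>e \<notin> E\<close> pos_def_formD(2)[OF B, of w e] by (simp add: algebra_simps)
  qed
qed

text \<open>The coordinate formula for the mean curvature is a trace: \<open>S\<close> is the sum of
  the forms B(.,e) B(.,e) weighted by \<open>S e e\<close>, and contracting each such form with the
  inverse Gram matrix gives 1.\<close>

lemma orthonormal_wrt_trace:
  fixes B S :: "real ^ 'm \<Rightarrow> real ^ 'm \<Rightarrow> real"
  assumes B: "pos_def_form B" and S: "bilinear S"
    and E: "finite E" "\<And>e e'. \<lbrakk>e \<in> E; e' \<in> E; e \<noteq> e'\<rbrakk> \<Longrightarrow> S e e' = 0"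
      "\<And>w. w = (\<Sum>e\<in>E. B w e *\<^sub>R e)" and ortho: "orthonormal_wrt B E"
  shows "(\<Sum>i\<in>UNIV. \<Sum>j\<in>UNIV. matrix_inv (\<chi> i j. B (axis i 1) (axis j 1)) $ i $ j
      * S (axis i 1) (axis j 1)) = (\<Sum>e\<in>E. S e e)"
proof -
  note b = pos_def_formD(1)[OF B]
  define G :: "real ^ 'm ^ 'm" where "G = (\<chi> i j. B (axis i 1) (axis j 1))"
  have linB: "linear (B u)" for u using b by (simp add: bilinear_def)
  have G: "(G *v u) $ i = B (axis i 1) u" for u i
  proof -
    have "B (axis i 1) u = B (axis i 1) (\<Sum>j\<in>UNIV. u $ j *\<^sub>R axis j 1)"
      using basis_expansion[of u] by (simp add: scalar_mult_eq_scaleR)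
    also have "\<dots> = (\<Sum>j\<in>UNIV. u $ j * B (axis i 1) (axis j 1))"
      by (simp add: linear_sum[OF linB] linear_cmul[OF linB])
    finally show ?thesis by (simp add: G_def matrix_vector_mult_def mult.commute)
  qed
  have "inj ((*v) G)"
  proof (rule injI)
    fix u v assume "G *v u = G *v v"
    then have "B u (axis i 1) = B v (axis i 1)" for i
      using G pos_def_formD(2)[OF B] by metis
    then have "B u b = B v b" if "b \<in> Basis" for b
      using that by (auto simp: Basis_vec_def)
    then have "B u = B v" using linear_eq_stdbasis[OF linB linB] by blast
    then show "u = v" using pos_def_form_eqI[OF B] by metis
  qed
  then have "invertible G"
    using invertible_left_inverse matrix_left_invertible_injective by blast
  then have inv: "matrix_inv G ** G = mat 1"
    using someI_ex[of "\<lambda>A'. G ** A' = mat 1 \<and> A' ** G = mat 1"]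
    by (simp add: invertible_def matrix_inv_def)
  have lr: "matrix_inv G *v (G *v e) = e" for e
    by (simp add: matrix_vector_mul_assoc inv)
  have S_diag: "S u v = (\<Sum>e\<in>E. B u e * B v e * S e e)" for u v
  proof -
    have "S u v = S (\<Sum>e\<in>E. B u e *\<^sub>R e) (\<Sum>e\<in>E. B v e *\<^sub>R e)"
      using E(3) by metis
    also have "\<dots> = (\<Sum>e\<in>E. \<Sum>e'\<in>E. B u e * B v e' * S e e')"
      by (simp add: bilinear_sum[OF S] sum.cartesian_product bilinear_lmul[OF S] bilinear_rmul[OF S]
          mult_ac)
    also have "\<dots> = (\<Sum>e\<in>E. \<Sum>e'\<in>E. if e' = e then B u e * B v e' * S e e' else 0)"
      using E(2) by (intro sum.cong) auto
    also have "\<dots> = (\<Sum>e\<in>E. B u e * B v e * S e e)" using E(1) by simp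
    finally show ?thesis .
  qed
  \<comment> \<open>The numbers \<open>B (axis i 1) e\<close> are the entries of
    \<open>G *v e\<close>, so the contraction collapses to \<open>B e e\<close>.\<close>
  have one: "(\<Sum>i\<in>UNIV. \<Sum>j\<in>UNIV. matrix_inv G $ i $ j * (B (axis i 1) e * B (axis j 1) e)) = 1"
    if "e \<in> E" for e
  proof -
    have "(\<Sum>i\<in>UNIV. \<Sum>j\<in>UNIV. matrix_inv G $ i $ j * (B (axis i 1) e * B (axis j 1) e))
      = (\<Sum>i\<in>UNIV. B (axis i 1) e * (matrix_inv G *v (G *v e)) $ i)"
      by (simp add: matrix_vector_mult_def[of "matrix_inv G"] G sum_distrib_left mult_ac)
    also have "\<dots> = (\<Sum>i\<in>UNIV. e $ i * B e (axis i 1))"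
      using pos_def_formD(2)[OF B, of e] by (simp add: lr mult.commute)
    also have "\<dots> = B e (\<Sum>i\<in>UNIV. e $ i *\<^sub>R axis i 1)"
      by (simp add: linear_sum[OF linB] linear_cmul[OF linB])
    also have "\<dots> = B e e" using basis_expansion[of e] by (simp add: scalar_mult_eq_scaleR)
    finally show ?thesis using ortho that by (simp add: orthonormal_wrt_def)
  qed
  have "(\<Sum>i\<in>UNIV. \<Sum>j\<in>UNIV. matrix_inv G $ i $ j * S (axis i 1) (axis j 1))
    = (\<Sum>i\<in>UNIV. \<Sum>j\<in>UNIV. \<Sum>e\<in>E. matrix_inv G $ i $ j * (B (axis i 1) e * B (axis j 1) e) * S e e)"
    by (subst S_diag) (simp add: sum_distrib_left mult.assoc)
  also have "\<dots> = (\<Sum>e\<in>E. \<Sum>i\<in>UNIV. \<Sum>j\<in>UNIV. matrix_inv G $ i $ j * (B (axis i 1) e * B (axis j 1) e) * S e e)"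
    by (simp add: sum.swap[of _ E])
  also have "\<dots> = (\<Sum>e\<in>E. S e e)"
    by (intro sum.cong) (simp_all only: sum_distrib_right[symmetric] one mult_1)
  finally show ?thesis by (simp add: G_def)
qed

text \<open>Each \<open>e\<close> is an eigenvector of \<open>A\<close> with eigenvalue
  \<open>S e e\<close>, and the eigenspace of \<open>c\<close> is spanned by the \<open>e\<close>
  with that value. Counting dimensions therefore only groups the sum over \<open>E\<close> by value.
  With squaring for \<open>r\<close> it evaluates \<open>shape_norm\<close>.\<close>

lemma eigenspace_weighted_sum:
  fixes A :: "'a::euclidean_space \<Rightarrow> 'a" and r :: "real \<Rightarrow> real"
  assumes B: "pos_def_form B" and S: "bilinear S" and A: "\<And>v w. B (A v) w = S v w"
    and E: "finite E" "\<And>e e'. \<lbrakk>e \<in> E; e' \<in> E; e \<noteq> e'\<rbrakk> \<Longrightarrow> S e e' = 0"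
      "\<And>w. w = (\<Sum>e\<in>E. B w e *\<^sub>R e)" and ortho: "orthonormal_wrt B E"
  shows "(\<Sum>c | \<exists>v. v \<noteq> 0 \<and> A v = c *\<^sub>R v. real (dim {v. A v = c *\<^sub>R v}) * r c) = (\<Sum>e\<in>E. r (S e e))"
proof -
  note b = pos_def_formD(1)[OF B]
  define l where "l e = S e e" for e
  have Svl: "S v e = B v e * l e" if "e \<in> E" for v e
  proof -
    have lin: "linear (\<lambda>u. S u e)" using S by (simp add: bilinear_def)
    have "S v e = S (\<Sum>e\<in>E. B v e *\<^sub>R e) e" using E(3) by metis
    also have "\<dots> = (\<Sum>e'\<in>E. B v e' * S e' e)"
      by (simp add: linear_sum[OF lin] linear_cmul[OF lin])
    also have "\<dots> = (\<Sum>e'\<in>E. if e' = e then B v e' * S e' e else 0)"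
      using E(2) that by (intro sum.cong) auto
    also have "\<dots> = B v e * l e" using E(1) that by (simp add: l_def)
    finally show ?thesis .
  qed
  have eq_iff: "u = v \<longleftrightarrow> (\<forall>e\<in>E. B u e = B v e)" for u v
    using E(3)[of u] E(3)[of v] by (metis (no_types, lifting) sum.cong)
  \<comment> \<open>In \<open>B\<close>-coordinates the equation reads (l e - c) B v e = 0 for every
    \<open>e\<close>.\<close>
  have eig: "A v = c *\<^sub>R v \<longleftrightarrow> (\<forall>e\<in>E. l e \<noteq> c \<longrightarrow> B v e = 0)" for v c
    by (subst eq_iff) (auto simp: A Svl bilinear_lmul[OF b])
  have E0: "e \<noteq> 0" if "e \<in> E" for e
    using ortho that bilinear_lzero[OF b] by (force simp: orthonormal_wrt_def)
  have space: "{v. A v = c *\<^sub>R v} = span {e\<in>E. l e = c}" for c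
  proof
    show "span {e\<in>E. l e = c} \<subseteq> {v. A v = c *\<^sub>R v}"
    proof (rule span_minimal)
      show "{e\<in>E. l e = c} \<subseteq> {v. A v = c *\<^sub>R v}"
        using ortho by (auto simp: eig orthonormal_wrt_def)
      show "subspace {v. A v = c *\<^sub>R v}"
        unfolding eig subspace_def
        by (auto simp: bilinear_lzero[OF b] bilinear_ladd[OF b] bilinear_lmul[OF b])
    qed
    show "{v. A v = c *\<^sub>R v} \<subseteq> span {e\<in>E. l e = c}"
    proof
      fix v assume "v \<in> {v. A v = c *\<^sub>R v}"
      then have "v = (\<Sum>e\<in>{e\<in>E. l e = c}. B v e *\<^sub>R e)"
        using E(1) by (subst E(3)) (auto simp: eig intro!: sum.mono_neutral_right)
      then show "v \<in> span {e\<in>E. l e = c}"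
        by (metis (no_types, lifting) span_base span_scale span_sum)
    qed
  qed
  have dim: "dim {v. A v = c *\<^sub>R v} = card {e\<in>E. l e = c}" for c
  proof -
    have "independent {e\<in>E. l e = c}"
      by (rule independent_mono[OF orthonormal_wrt_independent[OF b ortho E(1)]]) blast
    then show ?thesis unfolding space dim_span by (rule dim_eq_card_independent)
  qed
  have ev: "{c. \<exists>v. v \<noteq> 0 \<and> A v = c *\<^sub>R v} = l ` E"
  proof
    show "{c. \<exists>v. v \<noteq> 0 \<and> A v = c *\<^sub>R v} \<subseteq> l ` E"
    proof
      fix c assume "c \<in> {c. \<exists>v. v \<noteq> 0 \<and> A v = c *\<^sub>R v}"
      then obtain v where v: "v \<noteq> 0" "v \<in> span {e\<in>E. l e = c}" using space by blast
      have "{e\<in>E. l e = c} \<noteq> {}"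
      proof
        assume "{e\<in>E. l e = c} = {}"
        with v(2) have "v \<in> span {}" by (simp only:)
        with v(1) show False by simp
      qed
      then show "c \<in> l ` E" by blast
    qed
    show "l ` E \<subseteq> {c. \<exists>v. v \<noteq> 0 \<and> A v = c *\<^sub>R v}"
    proof clarify
      fix e assume "e \<in> E"
      then have "e \<in> span {e'\<in>E. l e' = l e}" by (intro span_base) simp
      then have "A e = l e *\<^sub>R e" unfolding space[symmetric] by simp
      then show "\<exists>v. v \<noteq> 0 \<and> A v = l e *\<^sub>R v" using E0[OF \<open>e \<in> E\<close>] by blast
    qed
  qed
  have "(\<Sum>c | \<exists>v. v \<noteq> 0 \<and> A v = c *\<^sub>R v. real (dim {v. A v = c *\<^sub>R v}) * r c)
    = (\<Sum>c\<in>l ` E. \<Sum>e | e \<in> E \<and> l e = c. r (l e))"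
    unfolding ev dim by (intro sum.cong) auto
  also have "\<dots> = (\<Sum>e\<in>E. r (l e))" using E(1) by (subst sum.image_gen[OF E(1), of _ l]) simp
  finally show ?thesis by (simp add: l_def)
qed


section \<open>Second derivatives\<close>

text \<open>The mean value theorem in direction \<open>v\<close> reduces the mixed second difference
  to a difference of first derivatives, which the derivative of \<open>D r v\<close> at the single
  point \<open>s\<close> controls. Continuity of second derivatives does not enter.\<close>

lemma second_difference_quotient:
  fixes F :: "'a::real_normed_vector \<Rightarrow> real"
  assumes V: "open V" "s \<in> V" and F: "\<And>r. r \<in> V \<Longrightarrow> (F has_derivative D r) (at r)"
    and L: "((\<lambda>r. D r v) has_derivative L) (at s)" and "0 < \<epsilon>"
  shows "\<exists>\<delta>>0. \<forall>t. 0 < t \<and> t < \<delta> \<longrightarrow>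
    \<bar>F (s + t *\<^sub>R v + t *\<^sub>R w) - F (s + t *\<^sub>R v) - F (s + t *\<^sub>R w) + F s - t\<^sup>2 * L w\<bar> \<le> \<epsilon> * t\<^sup>2"
proof -
  define K where "K = norm v + norm w + 1"
  have K: "K > 0" "norm v \<le> K" "norm w \<le> K" "norm w + norm v \<le> K" by (simp_all add: K_def add_nonneg_pos)
  \<comment> \<open>Two estimates of size e t K are added below; together they give \<epsilon>
    t.\<close>
  define e where "e = \<epsilon> / (2 * K)"
  have "e > 0" using \<open>0 < \<epsilon>\<close> K by (simp add: e_def)
  have linL: "linear L" using L has_derivative_linear by blast
  obtain d where d: "d > 0"
    "\<And>y. norm (y - s) < d \<Longrightarrow> norm (D y v - D s v - L (y - s)) \<le> e * norm (y - s)"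
    using L \<open>e > 0\<close> unfolding has_derivative_at_alt by blast
  obtain r where r: "r > 0" "ball s r \<subseteq> V" using V open_contains_ball by blast
  define \<delta> where "\<delta> = min d r / K"
  show ?thesis
  proof (intro exI[of _ \<delta>] conjI allI impI)
    show "0 < \<delta>" using d r K by (simp add: \<delta>_def)
    fix t assume t: "0 < t \<and> t < \<delta>"
    then have tK: "t * K < d" "t * K < r" using K by (simp_all add: \<delta>_def field_simps)
    \<comment> \<open>The increment of \<phi> from 0 to t is the whole second difference.\<close>
    define \<phi> where "\<phi> \<tau> = F (s + t *\<^sub>R w + \<tau> *\<^sub>R v) - F (s + \<tau> *\<^sub>R v)" for \<tau>
    have small: "norm (t *\<^sub>R w + \<tau> *\<^sub>R v) \<le> t * K" "norm (\<tau> *\<^sub>R v) \<le> t * K"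
      if "0 \<le> \<tau>" "\<tau> \<le> t" for \<tau>
    proof -
      have "norm (t *\<^sub>R w + \<tau> *\<^sub>R v) \<le> t * norm w + \<tau> * norm v"
        using norm_triangle_ineq[of "t *\<^sub>R w" "\<tau> *\<^sub>R v"] t that by simp
      also have "\<dots> \<le> t * norm w + t * norm v" using that by (simp add: mult_right_mono)
      also have "\<dots> \<le> t * K" using K t by (simp add: distrib_left[symmetric])
      finally show "norm (t *\<^sub>R w + \<tau> *\<^sub>R v) \<le> t * K" .
      show "norm (\<tau> *\<^sub>R v) \<le> t * K"
        using that t K mult_mono[of \<tau> t "norm v" K] by simp
    qed
    have inV: "s + t *\<^sub>R w + \<tau> *\<^sub>R v \<in> V" "s + \<tau> *\<^sub>R v \<in> V" if "0 \<le> \<tau>" "\<tau> \<le> t" for \<tau>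
    proof -
      have "dist s (s + y) = norm y" for y by (simp add: dist_norm)
      then have "dist s (s + t *\<^sub>R w + \<tau> *\<^sub>R v) < r" "dist s (s + \<tau> *\<^sub>R v) < r"
        using small[OF that] tK by (simp_all only: add.assoc)
      then show "s + t *\<^sub>R w + \<tau> *\<^sub>R v \<in> V" "s + \<tau> *\<^sub>R v \<in> V" using r(2) by auto
    qed
    have der: "(\<phi> has_real_derivative (D (s + t *\<^sub>R w + \<tau> *\<^sub>R v) v - D (s + \<tau> *\<^sub>R v) v)) (at \<tau>)"
      if "0 \<le> \<tau>" "\<tau> \<le> t" for \<tau>
    proof -
      have line: "((\<lambda>\<tau>. F (a + \<tau> *\<^sub>R v)) has_derivative (\<lambda>h. D (a + \<tau> *\<^sub>R v) (h *\<^sub>R v))) (at \<tau>)"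
        if "a + \<tau> *\<^sub>R v \<in> V" for a
        by (rule has_derivative_compose[where f="\<lambda>\<tau>. a + \<tau> *\<^sub>R v" and g=F and
              f'="\<lambda>h. h *\<^sub>R v" and g'="D (a + \<tau> *\<^sub>R v)"])
          (auto intro!: derivative_eq_intros F that)
      have lin: "D a (h *\<^sub>R v) = h * D a v" if "a \<in> V" for a h
        using linear_cmul[OF has_derivative_linear[OF F[OF that]]] by simp
      show ?thesis
        unfolding has_field_derivative_def \<phi>_def
        by (rule has_derivative_eq_rhs[OF
              has_derivative_diff[OF line[OF inV(1)[OF that]] line[OF inV(2)[OF that]]]])
          (simp add: fun_eq_iff lin[OF inV(1)[OF that]] lin[OF inV(2)[OF that]]
            left_diff_distrib mult.commute[of "_ - _"] mult.commute[of "D _ v"])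
    qed
    obtain \<theta> where \<theta>: "0 < \<theta>" "\<theta> < t"
      "\<phi> t - \<phi> 0 = (t - 0) * (D (s + t *\<^sub>R w + \<theta> *\<^sub>R v) v - D (s + \<theta> *\<^sub>R v) v)"
      using MVT2[of 0 t \<phi> "\<lambda>\<tau>. D (s + t *\<^sub>R w + \<tau> *\<^sub>R v) v - D (s + \<tau> *\<^sub>R v) v"] t der by blast
    \<comment> \<open>Both points compared lie within t K of \<open>s\<close>. Linearizing each at
      \<open>s\<close>, the common term \<open>D s v\<close> cancels and \<open>t * L w\<close>
      remains.\<close>
    have est: "\<bar>D (s + y) v - D s v - L y\<bar> \<le> e * (t * K)" if "norm y \<le> t * K" for y
    proof -
      have "\<bar>D (s + y) v - D s v - L y\<bar> \<le> e * norm y" using d(2)[of "s + y"] that tK by simp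
      also have "\<dots> \<le> e * (t * K)" using that \<open>e > 0\<close> by simp
      finally show ?thesis .
    qed
    have "L (t *\<^sub>R w + \<theta> *\<^sub>R v) - L (\<theta> *\<^sub>R v) = t * L w"
      using linear_add[OF linL] linear_cmul[OF linL] by simp
    then have "\<bar>D (s + t *\<^sub>R w + \<theta> *\<^sub>R v) v - D (s + \<theta> *\<^sub>R v) v - t * L w\<bar> \<le> 2 * (e * (t * K))"
      using est[OF small(1)[of \<theta>]] est[OF small(2)[of \<theta>]] \<theta> by (simp add: add.assoc)
    also have "\<dots> = \<epsilon> * t" using K by (simp add: e_def)
    finally have "t * \<bar>D (s + t *\<^sub>R w + \<theta> *\<^sub>R v) v - D (s + \<theta> *\<^sub>R v) v - t * L w\<bar> \<le> t * (\<epsilon> * t)"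
      using t by simp
    moreover have "F (s + t *\<^sub>R v + t *\<^sub>R w) - F (s + t *\<^sub>R v) - F (s + t *\<^sub>R w) + F s - t\<^sup>2 * L w
      = t * (D (s + t *\<^sub>R w + \<theta> *\<^sub>R v) v - D (s + \<theta> *\<^sub>R v) v - t * L w)"
      using \<theta>(3) by (simp add: \<phi>_def algebra_simps power2_eq_square)
    ultimately show "\<bar>F (s + t *\<^sub>R v + t *\<^sub>R w) - F (s + t *\<^sub>R v) - F (s + t *\<^sub>R w) + F s - t\<^sup>2 * L w\<bar>
        \<le> \<epsilon> * t\<^sup>2"
      using t by (simp add: abs_mult power2_eq_square mult_ac)
  qed
qed

text \<open>The second difference is symmetric in \<open>v\<close> and \<open>w\<close>, and after
  division by t^2 it tends both to \<open>L w\<close> and to \<open>L' v\<close>.\<close>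

lemma second_derivative_symmetric_real:
  fixes F :: "'a::real_normed_vector \<Rightarrow> real"
  assumes V: "open V" "s \<in> V" and F: "\<And>r. r \<in> V \<Longrightarrow> (F has_derivative D r) (at r)"
    and L: "((\<lambda>r. D r v) has_derivative L) (at s)" and L': "((\<lambda>r. D r w) has_derivative L') (at s)"
  shows "L w = L' v"
proof -
  have "\<bar>L w - L' v\<bar> \<le> 0 + \<epsilon>" if "\<epsilon> > 0" for \<epsilon>
  proof -
    have e2: "\<epsilon> / 2 > 0" using that by simp
    obtain d where d: "d > 0" "\<And>t. 0 < t \<and> t < d \<Longrightarrow>
      \<bar>F (s + t *\<^sub>R v + t *\<^sub>R w) - F (s + t *\<^sub>R v) - F (s + t *\<^sub>R w) + F s - t\<^sup>2 * L w\<bar> \<le> \<epsilon> / 2 * t\<^sup>2"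
      using second_difference_quotient[OF V F L e2, of w] by blast
    obtain d' where d': "d' > 0" "\<And>t. 0 < t \<and> t < d' \<Longrightarrow>
      \<bar>F (s + t *\<^sub>R w + t *\<^sub>R v) - F (s + t *\<^sub>R w) - F (s + t *\<^sub>R v) + F s - t\<^sup>2 * L' v\<bar> \<le> \<epsilon> / 2 * t\<^sup>2"
      using second_difference_quotient[OF V F L' e2, of v] by blast
    define t where "t = min d d' / 2"
    have t: "0 < t" "t < d" "t < d'" using d d' by (auto simp: t_def min_def)
    have swap: "s + t *\<^sub>R w + t *\<^sub>R v = s + t *\<^sub>R v + t *\<^sub>R w" by (simp only: add_ac)
    have "\<bar>t\<^sup>2 * L w - t\<^sup>2 * L' v\<bar> \<le> \<epsilon> * t\<^sup>2"
      using d(2)[of t] d'(2)[of t] t unfolding swap by argo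
    also have "t\<^sup>2 * L w - t\<^sup>2 * L' v = t\<^sup>2 * (L w - L' v)" by (simp add: right_diff_distrib)
    finally show ?thesis using t by (simp add: abs_mult mult.commute)
  qed
  then have "\<bar>L w - L' v\<bar> \<le> 0" by (rule field_le_epsilon)
  then show ?thesis by simp
qed

lemma second_derivative_symmetric:
  fixes F :: "'a::real_normed_vector \<Rightarrow> 'b::euclidean_space"
  assumes V: "open V" "s \<in> V" and F: "\<And>r. r \<in> V \<Longrightarrow> (F has_derivative D r) (at r)"
    and L: "((\<lambda>r. D r v) has_derivative L) (at s)" and L': "((\<lambda>r. D r w) has_derivative L') (at s)"
  shows "L w = L' v"
proof (rule euclidean_eqI)
  fix b :: 'b
  show "L w \<bullet> b = L' v \<bullet> b"
    by (rule second_derivative_symmetric_real[where F="\<lambda>r. F r \<bullet> b" and D="\<lambda>r h. D r h \<bullet> b", OF V])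
      (intro has_derivative_inner_left F L L' | assumption)+
qed

text \<open>If \<open>L v\<close> were positive, the derivative along \<open>v\<close>, which
  vanishes at \<open>s\<close>, would be positive just beyond it, and the mean value theorem would
  give a value above the maximum.\<close>

lemma second_derivative_nonpos_at_max:
  fixes F :: "'a::real_normed_vector \<Rightarrow> real"
  assumes V: "open V" "s \<in> V" and F: "\<And>r. r \<in> V \<Longrightarrow> (F has_derivative D r) (at r)"
    and L: "((\<lambda>r. D r v) has_derivative L) (at s)" and max: "\<And>r. r \<in> V \<Longrightarrow> F r \<le> F s"
  shows "D s v = 0" "L v \<le> 0"
proof -
  show D0: "D s v = 0" using differential_zero_maxmin[OF V(2,1) F[OF V(2)]] max by auto
  show "L v \<le> 0"
  proof (rule ccontr)
    assume "\<not> L v \<le> 0"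
    then have pos: "0 < L v" by simp
    have "((\<lambda>t. D (s + t *\<^sub>R v) v) has_derivative (\<lambda>h. L (h *\<^sub>R v))) (at 0)"
      by (rule has_derivative_compose[where f="\<lambda>t. s + t *\<^sub>R v" and g="\<lambda>r. D r v" and
            f'="\<lambda>h. h *\<^sub>R v" and g'=L]) (auto intro!: derivative_eq_intros L)
    then have "((\<lambda>t. D (s + t *\<^sub>R v) v) has_real_derivative L v) (at 0)"
      using linear_cmul[OF has_derivative_linear[OF L]]
      by (simp add: has_field_derivative_def mult.commute[of _ "L v"])
    from DERIV_pos_inc_right[OF this pos]
    obtain d where d: "d > 0" "\<And>t. 0 < t \<Longrightarrow> t < d \<Longrightarrow> 0 < D (s + t *\<^sub>R v) v" using D0 by auto
    obtain r where r: "r > 0" "ball s r \<subseteq> V" using V open_contains_ball by blast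
    \<comment> \<open>The summand 1 in the denominator keeps the quotient meaningful for
      \<open>v = 0\<close>; halving \<open>d\<close> gives the strict bound.\<close>
    define t where "t = min (d / 2) (r / (norm v + 1))"
    have t: "0 < t" "t < d" "t \<le> r / (norm v + 1)" using d r by (auto simp: t_def add_nonneg_pos)
    have inV: "s + \<tau> *\<^sub>R v \<in> V" if "0 \<le> \<tau>" "\<tau> \<le> t" for \<tau>
    proof -
      have "\<tau> * norm v \<le> t * norm v" using that by (simp add: mult_right_mono)
      also have "\<dots> < t * (norm v + 1)" using t by simp
      also have "\<dots> \<le> r" using t(3) by (simp add: pos_le_divide_eq add_nonneg_pos)
      finally have "dist s (s + \<tau> *\<^sub>R v) < r" using that by (simp add: dist_norm)
      then show ?thesis using r(2) by auto
    qed
    have der: "((\<lambda>t. F (s + t *\<^sub>R v)) has_real_derivative D (s + \<tau> *\<^sub>R v) v) (at \<tau>)"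
      if "0 \<le> \<tau>" "\<tau> \<le> t" for \<tau>
    proof -
      have "((\<lambda>t. F (s + t *\<^sub>R v)) has_derivative (\<lambda>h. D (s + \<tau> *\<^sub>R v) (h *\<^sub>R v))) (at \<tau>)"
        by (rule has_derivative_compose[where f="\<lambda>\<tau>. s + \<tau> *\<^sub>R v" and g=F and
              f'="\<lambda>h. h *\<^sub>R v" and g'="D (s + \<tau> *\<^sub>R v)"])
          (auto intro!: derivative_eq_intros F inV that)
      then show ?thesis
        using linear_cmul[OF has_derivative_linear[OF F[OF inV[OF that]]]]
        by (simp add: has_field_derivative_def mult.commute[of _ "D _ v"])
    qed
    obtain \<theta> where \<theta>: "0 < \<theta>" "\<theta> < t"
      "F (s + t *\<^sub>R v) - F (s + 0 *\<^sub>R v) = (t - 0) * D (s + \<theta> *\<^sub>R v) v"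
      using MVT2[of 0 t "\<lambda>t. F (s + t *\<^sub>R v)" "\<lambda>\<tau>. D (s + \<tau> *\<^sub>R v) v"] t der by blast
    have "0 < t * D (s + \<theta> *\<^sub>R v) v" using \<theta> t d(2)[of \<theta>] by simp
    then have "F s < F (s + t *\<^sub>R v)" using \<theta>(3) by simp
    then show False using max[OF inV[of t]] t by simp
  qed
qed


section \<open>The Bergman metric of the ball\<close>

lemma hermitian_simps [simp]:
  "hermitian (u + v) w = hermitian u w + hermitian v w"
  "hermitian w (u + v) = hermitian w u + hermitian w v"
  "hermitian (r *\<^sub>R u) w = r *\<^sub>R hermitian u w"
  "hermitian w (r *\<^sub>R u) = r *\<^sub>R hermitian w u"
  "hermitian (c *s u) w = c * hermitian u w"
  by (simp_all add: hermitian_def algebra_simps sum.distrib sum_distrib_left scaleR_sum_right)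

lemma cnj_hermitian: "cnj (hermitian u v) = hermitian v u"
  by (simp add: hermitian_def mult.commute)

lemma Re_hermitian: "Re (hermitian u v) = u \<bullet> v"
  by (simp add: hermitian_def inner_vec_def inner_complex_def)

lemma hermitian_self: "hermitian u u = of_real ((norm u)\<^sup>2)"
proof (rule complex_eqI)
  show "Re (hermitian u u) = Re (of_real ((norm u)\<^sup>2))"
    by (simp add: Re_hermitian power2_norm_eq_inner)
  have "cnj (hermitian u u) = hermitian u u" by (rule cnj_hermitian)
  then show "Im (hermitian u u) = Im (of_real ((norm u)\<^sup>2))" by (simp add: complex_eq_iff)
qed

lemma bounded_bilinear_hermitian: "bounded_bilinear (hermitian :: complex ^ 'n \<Rightarrow> _)"
  unfolding bilinear_conv_bounded_bilinear[symmetric] bilinear_def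
  by (intro conjI allI linearI) simp_all

lemma one_minus_norm_pos: "norm z < 1 \<Longrightarrow> 0 < 1 - (norm z)\<^sup>2"
  by (simp add: abs_square_less_1)

lemma CH_metric_eq:
  assumes "norm z < 1"
  shows "CH_metric z u v = Re (hermitian u v) / (1 - (norm z)\<^sup>2)
    + Re (hermitian u z * cnj (hermitian v z)) / (1 - (norm z)\<^sup>2)\<^sup>2"
proof -
  have "1 - (norm z)\<^sup>2 \<noteq> 0" using one_minus_norm_pos[OF assms] by simp
  then show ?thesis
    by (simp add: CH_metric_def cnj_hermitian add_divide_distrib power2_eq_square)
qed

lemma CH_metric_self:
  assumes "norm z < 1"
  shows "CH_metric z u u = (norm u)\<^sup>2 / (1 - (norm z)\<^sup>2)
    + (cmod (hermitian u z))\<^sup>2 / (1 - (norm z)\<^sup>2)\<^sup>2"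
  by (simp add: CH_metric_eq[OF assms] hermitian_self complex_norm_square[symmetric]
      flip: of_real_power)

lemma pos_def_CH_metric:
  assumes z: "norm z < 1"
  shows "pos_def_form (CH_metric z)"
proof -
  have d: "0 < 1 - (norm z)\<^sup>2" by (rule one_minus_norm_pos[OF z])
  have "bilinear (CH_metric z)"
    unfolding bilinear_def
    by (intro conjI allI linearI) (simp_all add: CH_metric_def algebra_simps add_divide_distrib diff_divide_distrib)
  moreover have "CH_metric z u v = CH_metric z v u" for u v
    using cnj_hermitian[of u v]
    by (simp add: CH_metric_eq[OF z] complex_eq_iff)
  moreover have "0 < CH_metric z u u" if "u \<noteq> 0" for u
    using that d unfolding CH_metric_self[OF z] by (intro add_pos_nonneg divide_pos_pos) simp_all
  ultimately show ?thesis unfolding pos_def_form_def by blast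
qed

lemma has_derivative_CH_metric:
  fixes p :: "complex ^ 'n"
  assumes p: "norm p < 1"
  defines "d \<equiv> 1 - (norm p)\<^sup>2"
  shows "((\<lambda>q. CH_metric q v w) has_derivative (\<lambda>u.
      (2 * Re (hermitian u p) * Re (hermitian v w)
         + Re (hermitian v u * hermitian p w + hermitian v p * hermitian u w)) / d\<^sup>2
      + 4 * Re (hermitian u p) * Re (hermitian v p * hermitian p w) / d ^ 3)) (at p)"
proof -
  have d: "d \<noteq> 0" using one_minus_norm_pos[OF p] by (simp add: d_def)
  have 1: "((\<lambda>q. hermitian v q) has_derivative (\<lambda>u. hermitian v u)) (at p)"
    using bounded_bilinear.bounded_linear_right[OF bounded_bilinear_hermitian]
    by (rule bounded_linear_imp_has_derivative)
  have 2: "((\<lambda>q. hermitian q w) has_derivative (\<lambda>u. hermitian u w)) (at p)"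
    using bounded_bilinear.bounded_linear_left[OF bounded_bilinear_hermitian]
    by (rule bounded_linear_imp_has_derivative)
  let ?N = "\<lambda>q. (1 - q \<bullet> q) * Re (hermitian v w) + Re (hermitian v q * hermitian q w)"
  let ?N' = "\<lambda>u. - 2 * (p \<bullet> u) * Re (hermitian v w)
    + Re (hermitian v u * hermitian p w + hermitian v p * hermitian u w)"
  have q: "((\<lambda>q. 1 - q \<bullet> q) has_derivative (\<lambda>u. - 2 * (p \<bullet> u))) (at p)"
    by (rule has_derivative_eq_rhs[OF has_derivative_diff[OF has_derivative_const
            has_derivative_inner[OF has_derivative_ident has_derivative_ident]]])
      (simp add: fun_eq_iff inner_commute)
  have N: "(?N has_derivative ?N') (at p)"
    by (rule has_derivative_eq_rhs[OF has_derivative_add[OF has_derivative_mult_left[OF q]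
            bounded_linear.has_derivative[OF bounded_linear_Re has_derivative_mult[OF 1 2]]]])
      (simp add: fun_eq_iff add_ac)
  have E: "((\<lambda>q. (1 - q \<bullet> q)\<^sup>2) has_derivative (\<lambda>u. - 4 * (1 - p \<bullet> p) * (p \<bullet> u))) (at p)"
    unfolding power2_eq_square
    by (rule has_derivative_eq_rhs[OF has_derivative_mult[OF q q]])
      (simp add: fun_eq_iff algebra_simps)
  have dp: "1 - p \<bullet> p = d" by (simp add: d_def power2_norm_eq_inner)
  have CH: "CH_metric q v w = ?N q / (1 - q \<bullet> q)\<^sup>2" for q
    by (simp add: CH_metric_def power2_norm_eq_inner)
  have der: "((\<lambda>q. CH_metric q v w) has_derivative
      (\<lambda>u. (?N' u * d\<^sup>2 - ?N p * (- 4 * d * (p \<bullet> u))) / (d\<^sup>2 * d\<^sup>2))) (at p)"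
    unfolding CH using has_derivative_divide'[OF N E] d unfolding dp by simp
  \<comment> \<open>Differentiating the denominator contributes 4 r k / d^2, which turns -2 r k into
    +2 r k. Sorting by powers of \<open>d\<close> prepares the comparison of coefficients in
    Koszul's formula.\<close>
  have alg: "((- 2 * r * k + x) * d\<^sup>2 - (d * k + y) * (- 4 * d * r)) / (d\<^sup>2 * d\<^sup>2)
      = (2 * r * k + x) / d\<^sup>2 + 4 * r * y / d ^ 3" for r k x y
    using d by (simp add: field_simps power2_eq_square power3_eq_cube)
  have eq: "(?N' u * d\<^sup>2 - ?N p * (- 4 * d * (p \<bullet> u))) / (d\<^sup>2 * d\<^sup>2) =
    (2 * Re (hermitian u p) * Re (hermitian v w)
         + Re (hermitian v u * hermitian p w + hermitian v p * hermitian u w)) / d\<^sup>2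
      + 4 * Re (hermitian u p) * Re (hermitian v p * hermitian p w) / d ^ 3" for u
    unfolding dp Re_hermitian[of u p] inner_commute[of p u] by (rule alg)
  show ?thesis by (rule has_derivative_eq_rhs[OF der]) (rule ext, rule eq)
qed

text \<open>The metric is Kaehler with potential -log(1 - |z|^2), so its Christoffel term is complex
  bilinear in \<open>u\<close> and \<open>v\<close>; the inverse metric applied to the derivative of
  the metric gives this closed form. The proof only checks it against Koszul's formula, and
  nondegeneracy gives uniqueness.\<close>

lemma christoffel_CH_metric:
  fixes p :: "complex ^ 'n"
  assumes p: "norm p < 1"
  shows "christoffel CH_metric p u v =
    (1 / (1 - (norm p)\<^sup>2)) *\<^sub>R (hermitian u p *s v + hermitian v p *s u)"
    (is "_ = ?c")
proof -
  let ?d = "1 - (norm p)\<^sup>2"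
  let ?D = "\<lambda>u v w. (2 * Re (hermitian u p) * Re (hermitian v w)
         + Re (hermitian v u * hermitian p w + hermitian v p * hermitian u w)) / ?d\<^sup>2
      + 4 * Re (hermitian u p) * Re (hermitian v p * hermitian p w) / ?d ^ 3"
  have d: "?d \<noteq> 0" using one_minus_norm_pos[OF p] by simp
  have D: "frechet_derivative (\<lambda>q. CH_metric q v w) (at p) u = ?D u v w" for u v w
    by (simp only: frechet_derivative_at[OF has_derivative_CH_metric[OF p], symmetric])
  have koszul: "2 * CH_metric p ?c w = ?D u v w + ?D v u w - ?D w u v" for w
  proof -
    \<comment> \<open>Naming the six Hermitian products turns Koszul's formula into an identity of
      real parts of complex polynomials, checked separately for the coefficients of 1/d^2 and
      1/d^3.\<close>
    define a b c e f k where "a = hermitian u p" and "b = hermitian v p" and "c = hermitian w p"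
      and "e = hermitian u v" and "f = hermitian u w" and "k = hermitian v w"
    have flip: "hermitian p w = cnj c" "hermitian p v = cnj b" "hermitian v u = cnj e"
      "hermitian w v = cnj k" "hermitian w u = cnj f" "hermitian p u = cnj a"
      by (simp_all add: a_def b_def c_def e_def f_def k_def cnj_hermitian)
    have alg: "(x + y - z) / m + (x' + y' - z') / m' = (x / m + x' / m') + (y / m + y' / m') - (z / m + z' / m')"
      for x y z x' y' z' m m' :: real
      by (simp add: add_divide_distrib diff_divide_distrib)
    have "2 * CH_metric p ?c w = 2 * Re (a * k + b * f) / ?d\<^sup>2 + 4 * Re (a * b * cnj c) / ?d ^ 3"
    proof -
      have alg2: "2 * (1 / m * x / m + 1 / m * (2 * y) / m\<^sup>2) = 2 * x / m\<^sup>2 + 4 * y / m ^ 3"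
        for x y m :: real
        by (simp add: power2_eq_square power3_eq_cube mult.assoc)
      have hw: "hermitian ?c w = (1 / ?d) *\<^sub>R (a * k + b * f)"
        and hp: "hermitian ?c p = (1 / ?d) *\<^sub>R (2 * (a * b))"
        by (simp_all add: a_def b_def f_def k_def)
      have "2 * CH_metric p ?c w
        = 2 * (1 / ?d * Re (a * k + b * f) / ?d + 1 / ?d * (2 * Re (a * b * cnj c)) / ?d\<^sup>2)"
        unfolding CH_metric_eq[OF p] hw hp c_def[symmetric] by (simp add: mult.assoc)
      also have "\<dots> = 2 * Re (a * k + b * f) / ?d\<^sup>2 + 4 * Re (a * b * cnj c) / ?d ^ 3"
        by (rule alg2)
      finally show ?thesis .
    qed
    also have "\<dots> = (2 * Re a * Re k + Re (cnj e * cnj c + b * f)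
        + (2 * Re b * Re f + Re (e * cnj c + a * k)) - (2 * Re c * Re e + Re (f * cnj b + a * cnj k))) / ?d\<^sup>2
      + (4 * Re a * Re (b * cnj c) + 4 * Re b * Re (a * cnj c) - 4 * Re c * Re (a * cnj b)) / ?d ^ 3"
      by (intro arg_cong2[where f="(+)"] arg_cong2[where f="(/)"] refl) (simp_all add: algebra_simps)
    also have "\<dots> = ?D u v w + ?D v u w - ?D w u v"
      unfolding flip a_def[symmetric] b_def[symmetric] c_def[symmetric] e_def[symmetric]
        f_def[symmetric] k_def[symmetric]
      by (rule alg)
    finally show ?thesis .
  qed
  show ?thesis
    unfolding christoffel_def D
  proof (rule the_equality)
    show "\<forall>w. 2 * CH_metric p ?c w = ?D u v w + ?D v u w - ?D w u v" using koszul by blast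
    fix c assume "\<forall>w. 2 * CH_metric p c w = ?D u v w + ?D v u w - ?D w u v"
    then have "2 * CH_metric p c w = 2 * CH_metric p ?c w" for w using koszul by metis
    then show "c = ?c" using pos_def_form_eqI[OF pos_def_CH_metric[OF p], of c ?c] by simp
  qed
qed

text \<open>The two terms of the metric combine because (1 - |z|^2) + |z|^2 = 1. Orthogonality to
  the position vector thus means the same for the Bergman and the Euclidean metric.\<close>

lemma CH_metric_position:
  assumes "norm z < 1"
  shows "CH_metric z u z = (u \<bullet> z) / (1 - (norm z)\<^sup>2)\<^sup>2"
  using assms
  by (simp add: CH_metric_def hermitian_self Re_hermitian[symmetric] algebra_simps flip: of_real_power)


section \<open>Principal curvatures of a hypersurface\<close>

locale hypersurface_point =
  fixes g :: "'e::euclidean_space metric" and x :: "real ^ 'm \<Rightarrow> 'e" and s :: "real ^ 'm" and \<nu> :: 'e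
  assumes pos_def: "pos_def_form (g (x s))"
    and linear_tangent: "linear (frechet_derivative x (at s))"
    and inj_tangent: "inj (frechet_derivative x (at s))"
    and codim: "DIM('e) = Suc (CARD('m))"
    and unit_normal: "unit_normal g x s \<nu>"
begin

abbreviation tangent :: "real ^ 'm \<Rightarrow> 'e" where
  "tangent \<equiv> frechet_derivative x (at s)"

text \<open>The coefficient of \<sigma>(v,w) along \<nu>. The projection to the normal line can be
  omitted, since pairing with \<nu> kills the tangential part.\<close>

definition second_form :: "real ^ 'm \<Rightarrow> real ^ 'm \<Rightarrow> real" where
  "second_form v w = g (x s) (cov_along g x v (\<lambda>r. frechet_derivative x (at r) w) s) \<nu>"

lemma bilinear_metric: "bilinear (g (x s))"
  using pos_def by (rule pos_def_formD)

lemma metric_commute: "g (x s) u v = g (x s) v u"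
  using pos_def by (rule pos_def_formD)

lemma normal_unit: "g (x s) \<nu> \<nu> = 1" "g (x s) (tangent v) \<nu> = 0"
proof -
  have "sqrt (g (x s) \<nu> \<nu>) = 1" and "g (x s) \<nu> (tangent v) = 0"
    using unit_normal by (simp_all add: unit_normal_def normal_vector_def metric_norm_def)
  then show "g (x s) \<nu> \<nu> = 1" "g (x s) (tangent v) \<nu> = 0"
    using metric_commute by simp_all
qed

text \<open>A dimension count: the right side omits \<nu>, so its dimension is at most m, while
  injectivity gives the tangent space dimension m.\<close>

lemma range_tangent: "range tangent = {y. g (x s) y \<nu> = 0}"
proof (rule subspace_dim_equal)
  let ?H = "{y. g (x s) y \<nu> = 0}"
  show "subspace (range tangent)"
    using linear_tangent by (simp add: linear_subspace_image)
  show H: "subspace ?H"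
    by (auto simp: subspace_def bilinear_lzero[OF bilinear_metric] bilinear_ladd[OF bilinear_metric]
        bilinear_lmul[OF bilinear_metric])
  show "range tangent \<subseteq> ?H" using normal_unit by auto
  have "\<nu> \<notin> ?H" using normal_unit by simp
  moreover have "span ?H = ?H" using H by (rule span_eq_iff[THEN iffD2])
  ultimately have "span ?H \<noteq> UNIV" by (metis UNIV_I)
  then have "dim ?H \<noteq> DIM('e)" using dim_eq_full by blast
  then have "dim ?H < Suc (CARD('m))" using dim_subset_UNIV[of ?H] codim by linarith
  moreover have "dim (range tangent) = CARD('m)"
    using dim_image_eq[OF linear_tangent] inj_tangent by (simp add: inj_on_subset)
  ultimately show "dim ?H \<le> dim (range tangent)" by simp
qed

text \<open>Subtracting the \<nu>-component leaves a vector that is both tangent and normal, hence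
  of length 0.\<close>

lemma normal_vector_eq:
  assumes "normal_vector g x s y"
  shows "y = g (x s) y \<nu> *\<^sub>R \<nu>"
proof -
  let ?y = "y - g (x s) y \<nu> *\<^sub>R \<nu>"
  have y\<nu>: "g (x s) ?y \<nu> = 0"
    by (simp add: bilinear_lsub[OF bilinear_metric] bilinear_lmul[OF bilinear_metric] normal_unit)
  then obtain v where v: "?y = tangent v" using range_tangent by blast
  have "g (x s) y ?y = 0" using assms unfolding v by (simp add: normal_vector_def)
  moreover have "g (x s) \<nu> ?y = 0" using y\<nu> metric_commute by simp
  ultimately have "g (x s) ?y ?y = 0"
    by (simp only: bilinear_lsub[OF bilinear_metric] bilinear_lmul[OF bilinear_metric]) simp
  then show ?thesis using pos_def_formD(4)[OF pos_def, of ?y] by simp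
qed

lemma normal_part_eq: "normal_part g x s y = g (x s) y \<nu> *\<^sub>R \<nu>"
  unfolding normal_part_def
proof (rule the_equality)
  have "g (x s) (y - g (x s) y \<nu> *\<^sub>R \<nu>) \<nu> = 0"
    by (simp add: bilinear_lsub[OF bilinear_metric] bilinear_lmul[OF bilinear_metric] normal_unit)
  moreover have "normal_vector g x s (g (x s) y \<nu> *\<^sub>R \<nu>)"
    using unit_normal
    by (simp add: unit_normal_def normal_vector_def bilinear_lmul[OF bilinear_metric])
  ultimately show "normal_vector g x s (g (x s) y \<nu> *\<^sub>R \<nu>)
      \<and> y - g (x s) y \<nu> *\<^sub>R \<nu> \<in> range tangent"
    unfolding range_tangent by blast
  fix \<mu> assume \<mu>: "normal_vector g x s \<mu> \<and> y - \<mu> \<in> range tangent"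
  then have "g (x s) (y - \<mu>) \<nu> = 0" unfolding range_tangent by blast
  then have "g (x s) \<mu> \<nu> = g (x s) y \<nu>" by (simp add: bilinear_lsub[OF bilinear_metric])
  then show "\<mu> = g (x s) y \<nu> *\<^sub>R \<nu>" using normal_vector_eq \<mu> by metis
qed

lemma second_fundamental_form_eq: "second_fundamental_form g x s v w = second_form v w *\<^sub>R \<nu>"
  by (simp add: second_fundamental_form_def normal_part_eq second_form_def)

lemma pos_def_induced: "pos_def_form (induced_metric g x s)"
  unfolding pos_def_form_def
proof (intro conjI allI impI)
  show "bilinear (induced_metric g x s)"
    unfolding bilinear_def induced_metric_def
    by (intro conjI allI linearI)
      (simp_all add: linear_add[OF linear_tangent] linear_cmul[OF linear_tangent]
        bilinear_ladd[OF bilinear_metric] bilinear_radd[OF bilinear_metric]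
        bilinear_lmul[OF bilinear_metric] bilinear_rmul[OF bilinear_metric])
  show "induced_metric g x s u v = induced_metric g x s v u" for u v
    unfolding induced_metric_def by (rule metric_commute)
  fix u :: "real ^ 'm" assume "u \<noteq> 0"
  then have "tangent u \<noteq> 0" using inj_tangent linear_injective_0[OF linear_tangent] by blast
  then show "0 < induced_metric g x s u u"
    unfolding induced_metric_def by (rule pos_def_formD(3)[OF pos_def])
qed

text \<open>Bilinearity is a hypothesis because the locale records data at one point only; it is
  obtained later from the second derivatives of the immersion.\<close>

lemma shape_operator_eq:
  assumes "bilinear second_form"
  shows "induced_metric g x s (shape_operator g x s \<nu> v) w = second_form v w"
proof -
  have "linear (second_form v)" using assms by (simp add: bilinear_def)
  then obtain a where a: "\<And>w. induced_metric g x s a w = second_form v w"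
    using pos_def_form_represents[OF pos_def_induced] by blast
  have "shape_operator g x s \<nu> v = a"
    unfolding shape_operator_def second_fundamental_form_eq
      bilinear_lmul[OF bilinear_metric] normal_unit
  proof (rule the_equality)
    show "\<forall>w. induced_metric g x s a w = second_form v w *\<^sub>R 1" using a by simp
    fix b assume "\<forall>w. induced_metric g x s b w = second_form v w *\<^sub>R 1"
    then show "b = a" using pos_def_form_eqI[OF pos_def_induced] a by simp
  qed
  then show ?thesis using a by simp
qed

text \<open>One basis of principal directions serves both curvature quantities. The length of the
  mean curvature vector sees the trace only up to sign, which makes the choice of \<nu>
  harmless.\<close>

lemma principal_basis:
  assumes bil: "bilinear second_form" and sym: "\<And>v w. second_form v w = second_form w v"
  obtains E where "finite E" "card E = CARD('m)"
    "\<And>e. e \<in> E \<Longrightarrow> induced_metric g x s e e = 1"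
    "shape_norm g x s \<nu> = sqrt (\<Sum>e\<in>E. (second_form e e)\<^sup>2)"
    "metric_norm g (x s) (mean_curvature_vector g x s) = \<bar>\<Sum>e\<in>E. second_form e e\<bar> / CARD('m)"
proof -
  let ?B = "induced_metric g x s"
  obtain E where fin: "finite E" and card: "card E = dim (UNIV :: (real ^ 'm) set)"
    and ortho: "orthonormal_wrt ?B E"
    and diag: "\<And>e e'. \<lbrakk>e \<in> E; e' \<in> E; e \<noteq> e'\<rbrakk> \<Longrightarrow> second_form e e' = 0"
    and exp: "\<And>w. w = (\<Sum>e\<in>E. ?B w e *\<^sub>R e)"
    using simultaneous_diagonalization[OF pos_def_induced bil sym subspace_UNIV] by auto
  have "shape_norm g x s \<nu> = sqrt (\<Sum>e\<in>E. (second_form e e)\<^sup>2)"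
    unfolding shape_norm_def principal_curvatures_def
    by (subst eigenspace_weighted_sum[OF pos_def_induced bil shape_operator_eq[OF bil] fin diag exp ortho])
      simp_all
  moreover have "metric_norm g (x s) (mean_curvature_vector g x s)
    = \<bar>\<Sum>e\<in>E. second_form e e\<bar> / CARD('m)"
  proof -
    have "mean_curvature_vector g x s = ((\<Sum>e\<in>E. second_form e e) / CARD('m)) *\<^sub>R \<nu>"
      unfolding mean_curvature_vector_def gram_def second_fundamental_form_eq
      using orthonormal_wrt_trace[OF pos_def_induced bil fin diag exp ortho]
      by (simp add: scaleR_sum_left[symmetric])
    then show ?thesis
      by (simp add: metric_norm_def bilinear_lmul[OF bilinear_metric]
          bilinear_rmul[OF bilinear_metric] normal_unit real_sqrt_divide)
  qed
  ultimately show thesis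
    using that[of E] fin card ortho by (simp add: orthonormal_wrt_def dim_UNIV)
qed

end

text \<open>With t = m|H|, \<open>C_bound\<close> is the larger root in y of 2(n + 1) y^2 + 3 t y -
  t^2 - 4(n - 1), so it suffices that this polynomial is positive at y = |A|.\<close>

lemma C_bound_less:
  assumes n: "n \<ge> 1" and E: "finite E" "card E = 2 * n - 1"
    and trace: "real (card E) \<le> \<bar>\<Sum>e\<in>E. l e\<bar>"
  shows "C_bound n (\<bar>\<Sum>e\<in>E. l e\<bar> / card E) < sqrt (\<Sum>e\<in>E. (l e)\<^sup>2)"
proof -
  define t P where "t = \<bar>\<Sum>e\<in>E. l e\<bar>" and "P = sqrt (\<Sum>e\<in>E. (l e)\<^sup>2)"
  define N where "N = real n"
  have N: "N \<ge> 1" and m: "real (card E) = 2 * N - 1" using n E by (simp_all add: N_def of_nat_diff)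
  have P: "P \<ge> 0" "P\<^sup>2 = (\<Sum>e\<in>E. (l e)\<^sup>2)" by (simp_all add: P_def sum_nonneg)
  have t: "2 * N - 1 \<le> t" using trace m by (simp add: t_def)
  have tP: "t\<^sup>2 \<le> P\<^sup>2 * (2 * N - 1)"
    using sum_squared_le_sum_of_squares[of l E] by (simp add: t_def P m)
  have "(2 * N - 1)\<^sup>2 \<le> t\<^sup>2" using t N by (intro power_mono) auto
  then have "(2 * N - 1) * (2 * N - 1) \<le> P\<^sup>2 * (2 * N - 1)"
    using tP by (simp add: power2_eq_square)
  then have "2 * N - 1 \<le> P\<^sup>2" using N by simp
  then have "0 < 2 * (N + 1) * P\<^sup>2 - t\<^sup>2 - 4 * (N - 1)" using tP N by (simp add: algebra_simps)
  \<comment> \<open>The factor 8(N + 1) completes the square to (4(N + 1) P + 3 t)^2.\<close>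
  then have "0 < 8 * (N + 1) * (2 * (N + 1) * P\<^sup>2 - t\<^sup>2 - 4 * (N - 1))" using N by simp
  also have "\<dots> \<le> 8 * (N + 1) * (2 * (N + 1) * P\<^sup>2 - t\<^sup>2 - 4 * (N - 1)) + 24 * (N + 1) * P * t"
    using N P t by simp
  also have "\<dots> = (4 * (N + 1) * P + 3 * t)\<^sup>2 - ((8 * N + 17) * t\<^sup>2 + 32 * (N\<^sup>2 - 1))"
    by (simp add: power2_eq_square algebra_simps)
  finally have "sqrt ((8 * N + 17) * t\<^sup>2 + 32 * (N\<^sup>2 - 1)) < 4 * (N + 1) * P + 3 * t"
    using N P t by (intro real_less_lsqrt) auto
  moreover have "C_bound n (t / card E) = (sqrt ((8 * N + 17) * t\<^sup>2 + 32 * (N\<^sup>2 - 1)) - 3 * t) / (4 * (N + 1))"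
  proof -
    have e: "(2 * N - 1) * (t / (2 * N - 1)) = t" using N by simp
    then have "(2 * N - 1)\<^sup>2 * (t / (2 * N - 1))\<^sup>2 = t\<^sup>2" by (metis power_mult_distrib)
    with e show ?thesis unfolding C_bound_def m N_def[symmetric] by (simp only: mult.assoc)
  qed
  ultimately show ?thesis unfolding t_def[symmetric] P_def[symmetric] using N
    by (simp add: divide_less_eq mult_ac)
qed


section \<open>The point farthest from the origin\<close>

text \<open>With \<open>d = 1 - |z|\<^sup>2\<close> and \<open>u\<close> the tangent vector of coordinates \<open>v\<close>, the product of the position
  vector \<open>z\<close> with \<open>\<sigma>(v,v)\<close> is at most \<open>- |u|\<^sup>2/d\<^sup>2 - 2|\<langle>u,z\<rangle>|\<^sup>2/d\<^sup>3\<close>. The first term comes from the second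
  derivative of \<open>|x|\<^sup>2\<close>; the second is the Christoffel term, where \<open>\<langle>u,z\<rangle>\<^sup>2 = - |\<langle>u,z\<rangle>|\<^sup>2\<close> because
  \<open>\<langle>u,z\<rangle>\<close> is imaginary for tangent \<open>u\<close>.\<close>

lemma norm_maximum_shape:
  fixes x :: "real ^ 'm \<Rightarrow> complex ^ 'n" and s :: "real ^ 'm"
  assumes card: "CARD('m) = 2 * CARD('n) - 1"
    and V: "open V" "s \<in> V" "smooth_on V x"
    and inj: "inj (frechet_derivative x (at s))"
    and ball: "norm (x s) < 1" and max: "\<And>r. r \<in> V \<Longrightarrow> norm (x r) \<le> norm (x s)"
    and \<nu>: "unit_normal CH_metric x s \<nu>"
  shows "C_bound CARD('n) (metric_norm CH_metric (x s) (mean_curvature_vector CH_metric x s))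
    < shape_norm CH_metric x s \<nu>"
proof -
  define z where "z = x s"
  define d where "d = 1 - (norm z)\<^sup>2"
  define D where "D r = frechet_derivative x (at r)" for r
  define L where "L v = frechet_derivative (\<lambda>r. D r v) (at s)" for v
  have d: "0 < d" using one_minus_norm_pos[OF ball] by (simp add: d_def z_def)
  have C2: "Ck_on (Suc (Suc 0)) V x" using V(3) unfolding smooth_on_def by blast
  have D: "(x has_derivative D r) (at r)" if "r \<in> V" for r
    using C2 that by (simp add: frechet_derivative_works D_def)
  have L: "((\<lambda>r. D r v) has_derivative L v) (at s)" for v
    using C2 V(2) by (simp add: frechet_derivative_works[symmetric] D_def L_def)
  have linD: "linear (D s)" and linL: "linear (L v)" for v
    using has_derivative_linear D[OF V(2)] L by blast+
  have Lsym: "L v w = L w v" for v w by (rule second_derivative_symmetric[OF V(1,2) D L L])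
  have "DIM(complex ^ 'n) = Suc (CARD('m))" using card by simp
  then interpret hypersurface_point CH_metric x s \<nu>
    using pos_def_CH_metric[OF ball] linD inj \<nu> unfolding D_def
    by (intro hypersurface_point.intro)
  define \<Gamma> where "\<Gamma> u v = (1 / d) *\<^sub>R (hermitian u z *s v + hermitian v z *s u)" for u v
  \<comment> \<open>\<open>L w v\<close> differentiates the tangent field of coordinates
    \<open>w\<close> in direction \<open>v\<close>, hence the swapped arguments.\<close>
  have form: "second_form v w = CH_metric z (L w v + \<Gamma> (D s v) (D s w)) \<nu>" for v w
    unfolding second_form_def cov_along_def christoffel_CH_metric[OF ball]
    by (simp add: z_def \<Gamma>_def d_def L_def D_def)
  have \<Gamma>_add: "\<Gamma> (u + u') v = \<Gamma> u v + \<Gamma> u' v" and \<Gamma>_scale: "\<Gamma> (r *\<^sub>R u) v = r *\<^sub>R \<Gamma> u v"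
    and \<Gamma>_sym: "\<Gamma> u v = \<Gamma> v u" for u u' v r
    by (simp_all add: \<Gamma>_def vec_eq_iff algebra_simps)
  have sym: "second_form v w = second_form w v" for v w
    unfolding form by (simp only: Lsym \<Gamma>_sym)
  have lin: "linear (\<lambda>v. second_form v w)" for w
    by (rule linearI)
      (simp_all add: form z_def linear_add[OF linL] linear_cmul[OF linL] linear_add[OF linD]
        linear_cmul[OF linD] \<Gamma>_add \<Gamma>_scale bilinear_ladd[OF bilinear_metric]
        bilinear_lmul[OF bilinear_metric] distrib_left)
  have bil: "bilinear second_form"
    unfolding bilinear_def using lin sym by (metis (no_types, lifting) ext)
  \<comment> \<open>First and second derivative tests for the squared norm, which unlike the norm is
    smooth at the origin as well.\<close>
  have max2: "D s v \<bullet> z = 0" "L v v \<bullet> z + (norm (D s v))\<^sup>2 \<le> 0" for v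
  proof -
    have F: "((\<lambda>r. x r \<bullet> x r) has_derivative (\<lambda>u. 2 * (D r u \<bullet> x r))) (at r)" if "r \<in> V" for r
      by (rule has_derivative_eq_rhs[OF has_derivative_inner[OF D[OF that] D[OF that]]])
        (simp add: fun_eq_iff inner_commute)
    have F': "((\<lambda>r. 2 * (D r v \<bullet> x r)) has_derivative
      (\<lambda>u. 2 * (L v u \<bullet> x s + D s v \<bullet> D s u))) (at s)"
      by (rule has_derivative_eq_rhs[OF has_derivative_mult_right[OF
              has_derivative_inner[OF L D[OF V(2)]]]]) (simp add: fun_eq_iff)
    have "x r \<bullet> x r \<le> x s \<bullet> x s" if "r \<in> V" for r
      using max[OF that] by (simp add: norm_le)
    from second_derivative_nonpos_at_max[OF V(1,2) F F' this]
    show "D s v \<bullet> z = 0" "L v v \<bullet> z + (norm (D s v))\<^sup>2 \<le> 0"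
      by (simp_all add: z_def power2_norm_eq_inner)
  qed
  have pos: "CH_metric z u z = (u \<bullet> z) / d\<^sup>2" for u
    using CH_metric_position[of z u] ball by (simp add: z_def d_def)
  \<comment> \<open>The sign of \<open>\<kappa>\<close> tells the two unit normals apart.\<close>
  define \<kappa> where "\<kappa> = CH_metric z z \<nu>"
  have "normal_vector CH_metric x s z"
    unfolding normal_vector_def
  proof
    fix v show "CH_metric (x s) z (tangent v) = 0"
      using pos[of "D s v"] max2(1)[of v] metric_commute[of z "D s v"] by (simp add: z_def D_def)
  qed
  then have z\<nu>: "z = \<kappa> *\<^sub>R \<nu>" using normal_vector_eq by (simp add: \<kappa>_def z_def)
  have z_normal: "CH_metric z y z = \<kappa> * CH_metric z y \<nu>" for y
    using bilinear_rmul[OF bilinear_metric, of y \<kappa> \<nu>, folded z_def] by (simp flip: z\<nu>)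
  have "\<kappa>\<^sup>2 = CH_metric z z z" by (simp add: z_normal \<kappa>_def[symmetric] power2_eq_square)
  also have "\<dots> = (norm z / d)\<^sup>2" by (simp add: pos power2_norm_eq_inner power_divide)
  finally have "\<bar>\<kappa>\<bar>\<^sup>2 = (norm z / d)\<^sup>2" by simp
  then have "\<bar>\<kappa>\<bar> = norm z / d" by (rule power2_eq_imp_eq) (use d in simp_all)
  \<comment> \<open>Passing from |z| to 1 relaxes the bound coth r to 1. Bounding \<kappa> from
    above instead of dividing by it avoids a case split at \<open>z = 0\<close>.\<close>
  moreover have "norm z / d \<le> 1 / d" using ball d by (intro divide_right_mono) (simp_all add: z_def)
  ultimately have \<kappa>: "\<bar>\<kappa>\<bar> \<le> 1 / d" by simp
  have form_le: "\<kappa> * second_form v v \<le> - (1 / d) * induced_metric CH_metric x s v v" for v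
  proof -
    define u a where "u = D s v" and "a = hermitian u z"
    have "Re a = 0" using max2(1)[of v] by (simp add: a_def u_def Re_hermitian)
    then have a2: "Re (a * a) = - (cmod a)\<^sup>2" unfolding cmod_power2 by (simp add: power2_eq_square)
    have "\<kappa> * second_form v v = CH_metric z (L v v + \<Gamma> u u) z"
      by (simp add: form u_def z_normal)
    also have "\<dots> = (L v v \<bullet> z + \<Gamma> u u \<bullet> z) / d\<^sup>2" by (simp add: pos inner_add_left)
    also have "\<Gamma> u u \<bullet> z = - 2 * (cmod a)\<^sup>2 / d"
    proof -
      have "hermitian (\<Gamma> u u) z = (2 / d) *\<^sub>R (a * a)"
        unfolding \<Gamma>_def a_def[symmetric] hermitian_simps by (simp add: scaleR_conv_of_real)
      then show ?thesis using a2 by (simp add: Re_hermitian[symmetric])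
    qed
    \<comment> \<open>The Christoffel term provides (cmod a)^2 twice, and the metric of
      \<open>u\<close> needs it only once. The surplus reflects the larger principal curvature 2
      coth 2r of the geodesic sphere in the direction of i z.\<close>
    also have "(L v v \<bullet> z + - 2 * (cmod a)\<^sup>2 / d) / d\<^sup>2 \<le> (- (norm u)\<^sup>2 - (cmod a)\<^sup>2 / d) / d\<^sup>2"
    proof (rule divide_right_mono)
      have "0 \<le> (cmod a)\<^sup>2 / d" using d by simp
      then show "L v v \<bullet> z + - 2 * (cmod a)\<^sup>2 / d \<le> - (norm u)\<^sup>2 - (cmod a)\<^sup>2 / d"
        using max2(2)[of v] by (simp add: u_def)
    qed simp
    also have "\<dots> = - (1 / d) * CH_metric z u u"
      using CH_metric_self[of z u] ball d unfolding d_def[symmetric] a_def[symmetric] z_def[symmetric]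
      by (simp add: field_simps power2_eq_square)
    finally show ?thesis by (simp add: induced_metric_def u_def D_def z_def)
  qed
  obtain E where E: "finite E" "card E = CARD('m)"
    "\<And>e. e \<in> E \<Longrightarrow> induced_metric CH_metric x s e e = 1"
    "shape_norm CH_metric x s \<nu> = sqrt (\<Sum>e\<in>E. (second_form e e)\<^sup>2)"
    "metric_norm CH_metric (x s) (mean_curvature_vector CH_metric x s)
      = \<bar>\<Sum>e\<in>E. second_form e e\<bar> / CARD('m)"
    using principal_basis[OF bil sym] by blast
  have "real (card E) \<le> \<bar>\<Sum>e\<in>E. second_form e e\<bar>"
  proof -
    \<comment> \<open>Summing with the factor \<kappa> in place, and taking absolute values only
      afterwards, treats both unit normals at once.\<close>
    have "\<kappa> * (\<Sum>e\<in>E. second_form e e) = (\<Sum>e\<in>E. \<kappa> * second_form e e)"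
      by (rule sum_distrib_left)
    also have "\<dots> \<le> (\<Sum>e\<in>E. - (1 / d))"
      using form_le E(3) by (intro sum_mono) (metis mult.right_neutral)
    finally have "real (card E) * (1 / d) \<le> - (\<kappa> * (\<Sum>e\<in>E. second_form e e))" by simp
    also have "\<dots> \<le> \<bar>\<kappa>\<bar> * \<bar>\<Sum>e\<in>E. second_form e e\<bar>" by (simp flip: abs_mult)
    also have "\<dots> \<le> (1 / d) * \<bar>\<Sum>e\<in>E. second_form e e\<bar>" using \<kappa> by (rule mult_right_mono) simp
    finally show ?thesis using d by (simp add: field_simps)
  qed
  from C_bound_less[OF _ E(1) _ this, of "CARD('n)"] show ?thesis
    using E card by simp
qed

text \<open>Smoothness is given only in charts. A chart is a homeomorphism and hence a quotient map,
  so continuity descends to its image, and the open images are pasted together.\<close>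

lemma hypersurface_continuous:
  assumes "real_hypersurface M \<A> f"
  shows "continuous_map M euclidean f"
proof (rule pasting_lemma[where I=\<A> and T="\<lambda>(V, \<phi>). \<phi> ` V" and f="\<lambda>_. f"])
  have atlas: "smooth_atlas M \<A>" using assms by (simp add: real_hypersurface_def smooth_manifold_def)
  fix c assume "c \<in> \<A>"
  then obtain V \<phi> where c: "c = (V, \<phi>)" "(V, \<phi>) \<in> \<A>" by (cases c) auto
  have chart: "openin M (\<phi> ` V)" "homeomorphic_map (top_of_set V) (subtopology M (\<phi> ` V)) \<phi>"
    using atlas c(2) unfolding smooth_atlas_def by blast+
  then show "openin M (case c of (V, \<phi>) \<Rightarrow> \<phi> ` V)" by (simp add: c)
  have "Ck_on 0 V (f \<circ> \<phi>)" using assms c(2) unfolding real_hypersurface_def smooth_on_def by blast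
  then have "continuous_map (top_of_set V) euclidean (f \<circ> \<phi>)" by simp
  moreover have "quotient_map (top_of_set V) (subtopology M (\<phi> ` V)) \<phi>"
    using chart(2) by (simp add: homeomorphic_map_def)
  ultimately show "continuous_map (subtopology M (case c of (V, \<phi>) \<Rightarrow> \<phi> ` V)) euclidean f"
    unfolding c(1) prod.case by (rule continuous_compose_quotient_map[rotated])
next
  fix p assume "p \<in> topspace M"
  then show "\<exists>c. c \<in> \<A> \<and> p \<in> (case c of (V, \<phi>) \<Rightarrow> \<phi> ` V) \<and> f p = f p"
    using assms unfolding real_hypersurface_def smooth_manifold_def smooth_atlas_def by blast
qed simp

theorem proposition5p9:
  fixes M :: "'a topology"
    and \<A> :: "('m::finite, 'a) param set"
    and f :: "'a \<Rightarrow> complex ^ 'n::finite"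
    and h :: real
  assumes "real_hypersurface M \<A> f"
    and "topspace M \<noteq> {}"
    and "compact_space M"
    and "constant_mean_curvature \<A> f h"
    and "sectional_curvature_ge \<A> f (-1)"
  shows "\<exists>p\<in>topspace M. \<forall>(V, \<phi>)\<in>\<A>. \<forall>s\<in>V. \<phi> s = p \<longrightarrow>
           (\<forall>\<nu>. unit_normal CH_metric (f \<circ> \<phi>) s \<nu> \<longrightarrow>
              shape_norm CH_metric (f \<circ> \<phi>) s \<nu> > C_bound CARD('n) h)"
proof -
  have "compact (f ` topspace M)"
    using image_compactin[OF _ hypersurface_continuous[OF assms(1)]] assms(3)
    by (simp add: compact_space_def)
  \<comment> \<open>The maximum is global on the hypersurface, so one point \<open>p\<close> serves
    every chart around it.\<close>
  then obtain p where p: "p \<in> topspace M" "\<And>q. q \<in> topspace M \<Longrightarrow> norm (f q) \<le> norm (f p)"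
    using continuous_attains_sup[of "f ` topspace M" norm] assms(2) continuous_on_norm_id by auto
  show ?thesis
  proof (intro bexI[OF _ p(1)] ballI, clarify)
    fix V \<phi> s \<nu>
    assume c: "(V, \<phi>) \<in> \<A>" "s \<in> V" "p = \<phi> s" and \<nu>: "unit_normal CH_metric (f \<circ> \<phi>) s \<nu>"
    have V: "open V" "\<phi> ` V \<subseteq> topspace M" "smooth_on V (f \<circ> \<phi>)"
      "inj (frechet_derivative (f \<circ> \<phi>) (at s))" "CARD('m) = 2 * CARD('n) - 1"
      "f ` topspace M \<subseteq> CH_ball"
      using assms(1) c unfolding real_hypersurface_def smooth_manifold_def smooth_atlas_def
      by blast+
    have "norm ((f \<circ> \<phi>) s) < 1" using V(6) p(1) c(3) by (auto simp: CH_ball_def)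
    moreover have "norm ((f \<circ> \<phi>) r) \<le> norm ((f \<circ> \<phi>) s)" if "r \<in> V" for r
      using p(2)[of "\<phi> r"] V(2) that c(3) by auto
    ultimately have "C_bound CARD('n) (metric_norm CH_metric ((f \<circ> \<phi>) s)
        (mean_curvature_vector CH_metric (f \<circ> \<phi>) s)) < shape_norm CH_metric (f \<circ> \<phi>) s \<nu>"
      using norm_maximum_shape[OF V(5,1) c(2) V(3,4) _ _ \<nu>] by blast
    moreover have "metric_norm CH_metric ((f \<circ> \<phi>) s) (mean_curvature_vector CH_metric (f \<circ> \<phi>) s) = h"
      using assms(4) c unfolding constant_mean_curvature_def by auto
    ultimately show "C_bound CARD('n) h < shape_norm CH_metric (f \<circ> \<phi>) s \<nu>" by simp
  qed
qed

end
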